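(* For every countable group $G$, there exists a connected orientable surface $S$ of infinite type without boundary such that $G$ is isomorphic to a subgroup of the mapping class group $\mathrm{Mod}(S)$.
   Context: A surface is a (Hausdorff, second countable) 2-dimensional topological manifold. A connected surface $S$ is of infinite type if $\pi_1(S)$ is infinitely generated (i.e. not finitely generated). The mapping class group $\mathrm{Mod}(S)$ is the group of homotopy classes of orientation-preserving homeomorphisms of $S$. (No condition is imposed on how homeomorphisms act on the ends of $S$.) *)

theory Defs
  imports "HOL-Analysis.Analysis" "HOL-Homology.Homology"
begin

section \<open>Surfaces\<close>

text \<open>A surface is covered by countably many charts, so up to homeomorphism its points can be taken
  from \<open>nat \<times> complex\<close> (or from any other type with the cardinality of the continuum).\<close>

definition surface :: "'a topology \<Rightarrow> bool" where
  "surface X \<longleftrightarrow> Hausdorff_space X \<and> second_countable X \<and>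
    (\<forall>x\<in>topspace X. \<exists>U (V :: (real^2) set).
       openin X U \<and> x \<in> U \<and> open V \<and> subtopology X U homeomorphic_space top_of_set V)"


section \<open>The fundamental group\<close>

text \<open>Paths are functions on all of \<open>real\<close>; only their values on the unit interval matter,
  because continuity and homotopy are taken with respect to \<open>top_of_set {0..1}\<close>.\<close>

definition loops :: "'a topology \<Rightarrow> 'a \<Rightarrow> (real \<Rightarrow> 'a) set" where
  "loops X a = {p. pathin X p \<and> p 0 = a \<and> p 1 = a}"

definition loop_homotopy :: "'a topology \<Rightarrow> 'a \<Rightarrow> ((real \<Rightarrow> 'a) \<times> (real \<Rightarrow> 'a)) set" where
  "loop_homotopy X a =
    {(p, q). homotopic_with (\<lambda>r. r 0 = a \<and> r 1 = a) (top_of_set {0..1}) X p q}"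

text \<open>The library operation \<open>joinpaths\<close> needs a type of class \<open>topological_space\<close>,
  whereas here the topology is not that of the type.\<close>

definition loop_join :: "(real \<Rightarrow> 'a) \<Rightarrow> (real \<Rightarrow> 'a) \<Rightarrow> real \<Rightarrow> 'a" where
  "loop_join p q = (\<lambda>t. if t \<le> 1/2 then p (2 * t) else q (2 * t - 1))"

definition fundamental_group :: "'a topology \<Rightarrow> 'a \<Rightarrow> (real \<Rightarrow> 'a) set monoid" where
  "fundamental_group X a =
    \<lparr>carrier = loops X a // loop_homotopy X a,
     mult = (\<lambda>P Q. \<Union>p\<in>P. \<Union>q\<in>Q. loop_homotopy X a `` {loop_join p q}),
     one = loop_homotopy X a `` {\<lambda>t. a}\<rparr>"

definition finitely_generated_group :: "('a, 'b) monoid_scheme \<Rightarrow> bool" where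
  "finitely_generated_group G \<longleftrightarrow> (\<exists>A\<subseteq>carrier G. finite A \<and> generate G A = carrier G)"

text \<open>Meant for connected surfaces, where the choice of base point is immaterial.\<close>

definition infinite_type :: "'a topology \<Rightarrow> bool" where
  "infinite_type X \<longleftrightarrow>
    (\<exists>a\<in>topspace X. \<not> finitely_generated_group (fundamental_group X a))"


section \<open>Orientations\<close>

text \<open>An orientation of a surface \<open>X\<close> chooses a generator of the infinite cyclic group
  \<open>H\<^sub>2(X, X - {x})\<close> for every point \<open>x\<close>, in such a way that near every point the chosen
  generators are the images of a single class in \<open>H\<^sub>2(X, X - U)\<close> for a neighbourhood \<open>U\<close>.\<close>

abbreviation local_homology :: "'a topology \<Rightarrow> 'a set \<Rightarrow> 'a chain set monoid" where
  "local_homology X U \<equiv> relative_homology_group 2 X (topspace X - U)"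

definition orientation :: "'a topology \<Rightarrow> ('a \<Rightarrow> 'a chain set) \<Rightarrow> bool" where
  "orientation X \<mu> \<longleftrightarrow>
    (\<forall>x\<in>topspace X. \<mu> x \<in> carrier (local_homology X {x}) \<and>
       generate (local_homology X {x}) {\<mu> x} = carrier (local_homology X {x})) \<and>
    (\<forall>x\<in>topspace X. \<exists>U. openin X U \<and> x \<in> U \<and>
       (\<exists>c\<in>carrier (local_homology X U). \<forall>y\<in>U.
          hom_induced 2 X (topspace X - U) X (topspace X - {y}) id c = \<mu> y))"

definition orientable :: "'a topology \<Rightarrow> bool" where
  "orientable X \<longleftrightarrow> (\<exists>\<mu>. orientation X \<mu>)"

text \<open>On a connected orientable surface there are exactly two orientations, differing by a sign,
  so a homeomorphism preserves one of them if and only if it preserves both.\<close>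

definition orientation_preserving :: "'a topology \<Rightarrow> ('a \<Rightarrow> 'a) \<Rightarrow> bool" where
  "orientation_preserving X f \<longleftrightarrow>
    (\<forall>\<mu>. orientation X \<mu> \<longrightarrow> (\<forall>x\<in>topspace X.
       hom_induced 2 X (topspace X - {x}) X (topspace X - {f x}) f (\<mu> x) = \<mu> (f x)))"


section \<open>The mapping class group\<close>

definition homeos_plus :: "'a topology \<Rightarrow> ('a \<Rightarrow> 'a) set" where
  "homeos_plus X = {f. homeomorphic_map X X f \<and> orientation_preserving X f}"

text \<open>The homotopies are arbitrary: they need not pass through homeomorphisms. Two functions that
  agree on \<open>topspace X\<close> are homotopic, so the values elsewhere do not matter.\<close>

definition mapping_class_rel :: "'a topology \<Rightarrow> (('a \<Rightarrow> 'a) \<times> ('a \<Rightarrow> 'a)) set" where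
  "mapping_class_rel X =
    {(f, g). f \<in> homeos_plus X \<and> g \<in> homeos_plus X \<and> homotopic_with (\<lambda>h. True) X X f g}"

definition mapping_class_group :: "'a topology \<Rightarrow> ('a \<Rightarrow> 'a) set monoid" where
  "mapping_class_group X =
    \<lparr>carrier = homeos_plus X // mapping_class_rel X,
     mult = (\<lambda>A B. \<Union>f\<in>A. \<Union>g\<in>B. mapping_class_rel X `` {f \<circ> g}),
     one = mapping_class_rel X `` {id}\<rparr>"


section \<open>Both constructions yield groups\<close>

lemma homotopic_loops_reparam:
  assumes w: "pathin X w"
    and \<phi>: "continuous_on {0..1} \<phi>" "\<phi> ` {0..1} \<subseteq> {0..1}"
    and \<psi>: "continuous_on {0..1} \<psi>" "\<psi> ` {0..1} \<subseteq> {0..1}"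
    and ends: "\<phi> 0 = \<psi> 0" "\<phi> 1 = \<psi> 1" "w (\<phi> 0) = a" "w (\<phi> 1) = a"
    and p: "\<And>t. t \<in> {0..1} \<Longrightarrow> p t = w (\<phi> t)"
    and q: "\<And>t. t \<in> {0..1} \<Longrightarrow> q t = w (\<psi> t)"
  shows "(p, q) \<in> loop_homotopy X a"
proof -
  let ?I = "top_of_set {0..1::real}"
  let ?h = "\<lambda>z. (1 - fst z) * \<phi> (snd z) + fst z * \<psi> (snd z) :: real"
  have c: "continuous_on ({0..1} \<times> {0..1}) ?h"
    by (intro continuous_intros continuous_on_compose2[OF \<phi>(1)] continuous_on_compose2[OF \<psi>(1)]) auto
  have r: "?h z \<in> {0..1}" if "z \<in> {0..1} \<times> {0..1}" for z
  proof -
    obtain t s where z: "z = (t, s)" by (cases z)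
    have "t \<in> {0..1}" "\<phi> s \<in> {0..1}" "\<psi> s \<in> {0..1}"
      using that z \<phi>(2) \<psi>(2) unfolding image_subset_iff by blast+
    then show ?thesis
      using convexD_alt[OF convex_real_interval(5), of "\<phi> s" 0 1 "\<psi> s" t] by (simp add: z)
  qed
  have cm: "continuous_map (prod_topology ?I ?I) ?I ?h"
    unfolding prod_topology_subtopology_eu continuous_map_subtopology_eu continuous_map_in_subtopology
    using c r by auto
  have e: "(1 - t) * x + t * x = x" for t x :: real
    by (simp add: algebra_simps)
  have "homotopic_with (\<lambda>r. r 0 = a \<and> r 1 = a) ?I X (w \<circ> \<phi>) (w \<circ> \<psi>)"
    unfolding homotopic_with_def
  proof (intro exI conjI)
    show "continuous_map (prod_topology ?I ?I) X (w \<circ> ?h)"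
      using cm w unfolding pathin_def by (rule continuous_map_compose)
  qed (use ends in \<open>simp_all add: e\<close>)
  then have "homotopic_with (\<lambda>r. r 0 = a \<and> r 1 = a) ?I X p q"
    by (rule homotopic_with_eq) (use p q in auto)
  then show ?thesis by (simp add: loop_homotopy_def)
qed

lemma equiv_loop_homotopy: "equiv (loops X a) (loop_homotopy X a)"
proof (rule equivI)
  show "loop_homotopy X a \<subseteq> loops X a \<times> loops X a"
  proof clarify
    fix p q assume "(p, q) \<in> loop_homotopy X a"
    then have *: "homotopic_with (\<lambda>r. r 0 = a \<and> r 1 = a) (top_of_set {0..1}) X p q"
      by (simp add: loop_homotopy_def)
    show "p \<in> loops X a \<and> q \<in> loops X a"
      using homotopic_with_imp_continuous_maps[OF *] homotopic_with_imp_property[OF *]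
      by (simp add: loops_def pathin_def)
  qed
  show "refl_on (loops X a) (loop_homotopy X a)"
    by (simp add: refl_on_def loop_homotopy_def loops_def pathin_def)
  show "sym (loop_homotopy X a)"
    by (auto simp: sym_def loop_homotopy_def intro: homotopic_with_symD)
  show "trans (loop_homotopy X a)"
    unfolding trans_def loop_homotopy_def by (blast intro: homotopic_with_trans)
qed

lemma loop_join_homotopy:
  assumes "(p, p') \<in> loop_homotopy X a" "(q, q') \<in> loop_homotopy X a"
  shows "(loop_join p q, loop_join p' q') \<in> loop_homotopy X a"
proof -
  let ?I = "top_of_set {0..1::real}"
  let ?II = "prod_topology ?I ?I"
  obtain h where h: "continuous_map ?II X h" "\<And>x. h (0, x) = p x"
      "\<And>x. h (1, x) = p' x" "\<And>t. t \<in> {0..1} \<Longrightarrow> h (t, 0) = a \<and> h (t, 1) = a"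
    using assms(1) unfolding loop_homotopy_def homotopic_with_def by blast
  obtain k where k: "continuous_map ?II X k" "\<And>x. k (0, x) = q x"
      "\<And>x. k (1, x) = q' x" "\<And>t. t \<in> {0..1} \<Longrightarrow> k (t, 0) = a \<and> k (t, 1) = a"
    using assms(2) unfolding loop_homotopy_def homotopic_with_def by blast
  have A: "continuous_map (subtopology ?II {z. z \<in> topspace ?II \<and> snd z \<le> 1/2}) X
             (h \<circ> (\<lambda>z. (fst z, 2 * snd z)))"
    by (rule continuous_map_compose[OF _ h(1)],
        unfold prod_topology_subtopology_eu subtopology_subtopology continuous_map_subtopology_eu)
      (auto intro!: continuous_intros)
  have B: "continuous_map (subtopology ?II {z. z \<in> topspace ?II \<and> 1/2 \<le> snd z}) X
             (k \<circ> (\<lambda>z. (fst z, 2 * snd z - 1)))"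
    by (rule continuous_map_compose[OF _ k(1)],
        unfold prod_topology_subtopology_eu subtopology_subtopology continuous_map_subtopology_eu)
      (auto intro!: continuous_intros)
  let ?f = "\<lambda>z. if snd z \<le> 1/2 then (h \<circ> (\<lambda>z. (fst z, 2 * snd z))) z
                else (k \<circ> (\<lambda>z. (fst z, 2 * snd z - 1))) z"
  have snd: "continuous_map ?II euclideanreal snd"
    unfolding prod_topology_subtopology_eu by (simp add: continuous_on_snd)
  have f: "continuous_map ?II X ?f"
  proof (rule continuous_map_cases_le[OF snd _ A B])
    fix z assume "z \<in> topspace ?II" "snd z = 1/2"
    then have "2 * snd z = 1" "2 * snd z - 1 = 0" "fst z \<in> {0..1}" by auto
    then show "(h \<circ> (\<lambda>z. (fst z, 2 * snd z))) z = (k \<circ> (\<lambda>z. (fst z, 2 * snd z - 1))) z"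
      using h(4)[of "fst z"] k(4)[of "fst z"] by (simp only: o_def)
  qed simp
  have "homotopic_with (\<lambda>r. r 0 = a \<and> r 1 = a) ?I X (loop_join p q) (loop_join p' q')"
    unfolding homotopic_with_def
    by (rule exI[of _ ?f]) (use f h(2-4) k(2-4) in \<open>simp add: loop_join_def\<close>)
  then show ?thesis by (simp add: loop_homotopy_def)
qed

lemma loop_join_loops:
  assumes "p \<in> loops X a" "q \<in> loops X a"
  shows "loop_join p q \<in> loops X a"
proof -
  have "(p, p) \<in> loop_homotopy X a" "(q, q) \<in> loop_homotopy X a"
    using assms equiv_loop_homotopy[of X a] by (simp_all add: equiv_def refl_on_def)
  then have "(loop_join p q, loop_join p q) \<in> loop_homotopy X a"
    by (rule loop_join_homotopy)
  then show ?thesis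
    using equiv_loop_homotopy[of X a] by (auto simp: equiv_def)
qed

lemma quotient_monoid_group:
  assumes E: "equiv A r"
    and cong: "\<And>p p' q q'. (p, p') \<in> r \<Longrightarrow> (q, q') \<in> r \<Longrightarrow> (f p q, f p' q') \<in> r"
    and e: "e \<in> A"
    and assoc: "\<And>p q s. p \<in> A \<Longrightarrow> q \<in> A \<Longrightarrow> s \<in> A \<Longrightarrow> (f (f p q) s, f p (f q s)) \<in> r"
    and unit: "\<And>p. p \<in> A \<Longrightarrow> (f e p, p) \<in> r"
    and inv: "\<And>p. p \<in> A \<Longrightarrow> \<exists>q\<in>A. (f q p, e) \<in> r"
  shows "Group.group \<lparr>carrier = A // r, mult = (\<lambda>P Q. \<Union>p\<in>P. \<Union>q\<in>Q. r `` {f p q}), one = r `` {e}\<rparr>"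
    (is "Group.group ?G")
proof -
  have cl: "f p q \<in> A" if "p \<in> A" "q \<in> A" for p q
    using cong[of p p q q] E that by (auto simp: equiv_def refl_on_def)
  have m: "(\<Union>p\<in>r``{p}. \<Union>q\<in>r``{q}. r `` {f p q}) = r `` {f p q}" if "p \<in> A" "q \<in> A" for p q
    by (rule UN_equiv_class2[OF E E _ that])
      (auto simp: congruent2_def intro!: equiv_class_eq[OF E] cong)
  have eqc: "r `` {p} = r `` {q}" if "(p, q) \<in> r" for p q
    using E that by (rule equiv_class_eq)
  show ?thesis
  proof (rule groupI)
    fix x y assume "x \<in> carrier ?G" "y \<in> carrier ?G"
    then obtain p q where "p \<in> A" "q \<in> A" "x = r``{p}" "y = r``{q}"
      by (auto elim!: quotientE)
    then show "x \<otimes>\<^bsub>?G\<^esub> y \<in> carrier ?G"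
      by (simp add: m quotientI cl)
  next
    show "\<one>\<^bsub>?G\<^esub> \<in> carrier ?G"
      by (simp add: quotientI e)
  next
    fix x y z assume "x \<in> carrier ?G" "y \<in> carrier ?G" "z \<in> carrier ?G"
    then obtain p q s where "p \<in> A" "q \<in> A" "s \<in> A" "x = r``{p}" "y = r``{q}" "z = r``{s}"
      by (auto elim!: quotientE)
    then show "x \<otimes>\<^bsub>?G\<^esub> y \<otimes>\<^bsub>?G\<^esub> z = x \<otimes>\<^bsub>?G\<^esub> (y \<otimes>\<^bsub>?G\<^esub> z)"
      by (simp add: m cl eqc assoc)
  next
    fix x assume "x \<in> carrier ?G"
    then obtain p where p: "p \<in> A" "x = r``{p}"
      by (auto elim!: quotientE)
    then show "\<one>\<^bsub>?G\<^esub> \<otimes>\<^bsub>?G\<^esub> x = x"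
      by (simp add: m e eqc unit)
    obtain q where "q \<in> A" "(f q p, e) \<in> r"
      using inv p by blast
    then show "\<exists>y\<in>carrier ?G. y \<otimes>\<^bsub>?G\<^esub> x = \<one>\<^bsub>?G\<^esub>"
      using p by (intro bexI[of _ "r``{q}"]) (simp_all add: m eqc quotientI)
  qed
qed

lemma group_fundamental_group:
  assumes a: "a \<in> topspace X"
  shows "Group.group (fundamental_group X a)"
  unfolding fundamental_group_def
proof (rule quotient_monoid_group[OF equiv_loop_homotopy loop_join_homotopy])
  show "(\<lambda>t. a) \<in> loops X a"
    using a by (simp add: loops_def pathin_def)
next
  fix p q s assume L: "p \<in> loops X a" "q \<in> loops X a" "s \<in> loops X a"
  let ?w = "loop_join p (loop_join q s)"
  let ?\<phi> = "\<lambda>t::real. min (2 * t) (min (t + 1/4) (t / 2 + 1/2))"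
  have w: "?w \<in> loops X a"
    by (intro loop_join_loops L)
  have ends: "p 0 = a" "p 1 = a" "q 0 = a" "q 1 = a" "s 0 = a" "s 1 = a"
    using L by (simp_all add: loops_def)
  show "(loop_join (loop_join p q) s, ?w) \<in> loop_homotopy X a"
  proof (rule homotopic_loops_reparam[where w = ?w and \<phi> = ?\<phi> and \<psi> = "\<lambda>t. t"])
    fix t :: real assume t: "t \<in> {0..1}"
    consider "t \<le> 1/4" | "1/4 < t" "t \<le> 1/2" | "1/2 < t" by linarith
    then show "loop_join (loop_join p q) s t = ?w (?\<phi> t)"
    proof cases
      case 1
      then have "?\<phi> t = 2 * t" using t by auto
      then show ?thesis using 1 t by (simp add: loop_join_def)
    next
      case 2
      then have "?\<phi> t = t + 1/4" using t by auto
      then show ?thesis using 2 t by (simp add: loop_join_def algebra_simps)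
    next
      case 3
      then have "?\<phi> t = t / 2 + 1/2" using t by auto
      then show ?thesis using 3 t by (simp add: loop_join_def algebra_simps)
    qed
  next
    show "?\<phi> ` {0..1} \<subseteq> {0..1}" by auto
  qed (use w ends in \<open>auto simp: loops_def loop_join_def intro!: continuous_intros\<close>)
next
  fix p assume p: "p \<in> loops X a"
  show "(loop_join (\<lambda>t. a) p, p) \<in> loop_homotopy X a"
  proof (rule homotopic_loops_reparam[where w = p and \<phi> = "\<lambda>t. max 0 (2 * t - 1)" and \<psi> = "\<lambda>t. t"])
    fix t :: real
    have "max 0 (2 * t - 1) = (if t \<le> 1/2 then 0 else 2 * t - 1)" by auto
    then show "loop_join (\<lambda>t. a) p t = p (max 0 (2 * t - 1))"
      using p by (simp only: loop_join_def loops_def mem_Collect_eq split: if_split) simp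
  qed (use p in \<open>auto simp: loops_def intro!: continuous_intros\<close>)
  define q where "q = (\<lambda>t. p (1 - t))"
  have "pathin X (p \<circ> (\<lambda>t. 1 - t))"
    unfolding pathin_def
  proof (rule continuous_map_compose)
    show "continuous_map (top_of_set {0..1}) (top_of_set {0..1}) (\<lambda>t::real. 1 - t)"
      unfolding continuous_map_subtopology_eu by (auto intro!: continuous_intros)
    show "continuous_map (top_of_set {0..1}) X p"
      using p by (simp add: loops_def pathin_def)
  qed
  then have q: "q \<in> loops X a"
    using p by (simp add: loops_def q_def o_def)
  have "(loop_join q p, \<lambda>t. a) \<in> loop_homotopy X a"
  proof (rule homotopic_loops_reparam[where w = p and \<phi> = "\<lambda>t. \<bar>1 - 2 * t\<bar>" and \<psi> = "\<lambda>t. 1"])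
    fix t :: real assume "t \<in> {0..1}"
    show "loop_join q p t = p \<bar>1 - 2 * t\<bar>"
      by (auto simp: loop_join_def q_def abs_if)
  qed (use p in \<open>auto simp: loops_def intro!: continuous_intros\<close>)
  with q show "\<exists>q\<in>loops X a. (loop_join q p, \<lambda>t. a) \<in> loop_homotopy X a" by blast
qed

lemma homeos_plus_id: "id \<in> homeos_plus X"
  by (auto simp: homeos_plus_def orientation_preserving_def orientation_def hom_induced_id)

lemma homeos_plus_comp:
  assumes f: "f \<in> homeos_plus X" and g: "g \<in> homeos_plus X"
  shows "g \<circ> f \<in> homeos_plus X"
proof -
  have F: "homeomorphic_map X X f" and G: "homeomorphic_map X X g"
    using f g by (auto simp: homeos_plus_def)
  have fx: "f x \<in> topspace X" if "x \<in> topspace X" for x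
    using F that by (auto simp: homeomorphic_eq_everything_map)
  have "orientation_preserving X (g \<circ> f)"
    unfolding orientation_preserving_def
  proof (intro allI impI ballI)
    fix \<mu> x assume \<mu>: "orientation X \<mu>" and x: "x \<in> topspace X"
    have *: "h \<in> (topspace X - {y}) \<rightarrow> topspace X - {h y}"
      if "homeomorphic_map X X h" "y \<in> topspace X" for h y
      using that by (auto simp: homeomorphic_eq_everything_map inj_on_def)
    have "hom_induced 2 X (topspace X - {x}) X (topspace X - {(g \<circ> f) x}) (g \<circ> f) (\<mu> x) =
          hom_induced 2 X (topspace X - {f x}) X (topspace X - {g (f x)}) g
            (hom_induced 2 X (topspace X - {x}) X (topspace X - {f x}) f (\<mu> x))"
      using hom_induced_compose'[OF homeomorphic_imp_continuous_map[OF F] *[OF F x]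
        homeomorphic_imp_continuous_map[OF G] *[OF G fx[OF x]]] by simp
    also have "\<dots> = \<mu> ((g \<circ> f) x)"
      using f g \<mu> x fx[OF x] by (simp add: homeos_plus_def orientation_preserving_def)
    finally show "hom_induced 2 X (topspace X - {x}) X (topspace X - {(g \<circ> f) x}) (g \<circ> f) (\<mu> x)
      = \<mu> ((g \<circ> f) x)" .
  qed
  then show ?thesis
    using homeomorphic_map_compose[OF F G] by (simp add: homeos_plus_def)
qed

lemma homeos_plus_inverse:
  assumes f: "f \<in> homeos_plus X"
  shows "\<exists>g\<in>homeos_plus X. \<forall>x\<in>topspace X. g (f x) = x"
proof -
  obtain g where fg: "homeomorphic_maps X X f g"
    using f by (auto simp: homeos_plus_def homeomorphic_map_maps)
  have F: "continuous_map X X f" and G: "continuous_map X X g"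
    and gf: "\<And>x. x \<in> topspace X \<Longrightarrow> g (f x) = x" "\<And>x. x \<in> topspace X \<Longrightarrow> f (g x) = x"
    using fg unfolding homeomorphic_maps_def by blast+
  have hg: "homeomorphic_map X X g"
    using fg homeomorphic_maps_sym homeomorphic_map_maps by blast
  have gx: "g x \<in> topspace X" if "x \<in> topspace X" for x
    using G that by (auto simp: continuous_map_def)
  have "orientation_preserving X g"
    unfolding orientation_preserving_def
  proof (intro allI impI ballI)
    fix \<mu> x assume \<mu>: "orientation X \<mu>" and x: "x \<in> topspace X"
    have fx: "f y \<in> topspace X" if "y \<in> topspace X" for y
      using F that by (auto simp: continuous_map_def)
    have 1: "f \<in> (topspace X - {g x}) \<rightarrow> topspace X - {x}"
    proof (rule Pi_I)
      fix y assume y: "y \<in> topspace X - {g x}"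
      then have "f y \<noteq> x" using gf(1)[of y] by auto
      with y fx show "f y \<in> topspace X - {x}" by simp
    qed
    have 2: "g \<in> (topspace X - {x}) \<rightarrow> topspace X - {g x}"
    proof (rule Pi_I)
      fix y assume y: "y \<in> topspace X - {x}"
      then have "g y \<noteq> g x" using gf(2)[of y] gf(2)[OF x] by auto
      with y gx show "g y \<in> topspace X - {g x}" by simp
    qed
    have "hom_induced 2 X (topspace X - {g x}) X (topspace X - {f (g x)}) f (\<mu> (g x)) = \<mu> (f (g x))"
      using f \<mu> gx[OF x] unfolding homeos_plus_def orientation_preserving_def by blast
    then have "hom_induced 2 X (topspace X - {g x}) X (topspace X - {x}) f (\<mu> (g x)) = \<mu> x"
      by (simp only: gf(2)[OF x])
    then have "hom_induced 2 X (topspace X - {x}) X (topspace X - {g x}) g (\<mu> x) =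
        hom_induced 2 X (topspace X - {g x}) X (topspace X - {g x}) (g \<circ> f) (\<mu> (g x))"
      using hom_induced_compose'[OF F 1 G 2] by metis
    also have "\<dots> = \<mu> (g x)"
    proof (rule hom_induced_id_gen)
      show "continuous_map X X (g \<circ> f)"
        using F G by (rule continuous_map_compose)
      show "\<mu> (g x) \<in> carrier (local_homology X {g x})"
        using \<mu> gx[OF x] unfolding orientation_def by blast
    qed (simp add: gf(1))
    finally show "hom_induced 2 X (topspace X - {x}) X (topspace X - {g x}) g (\<mu> x) = \<mu> (g x)" .
  qed
  with hg have "g \<in> homeos_plus X" by (simp add: homeos_plus_def)
  with gf(1) show ?thesis by blast
qed

lemma equiv_mapping_class_rel: "equiv (homeos_plus X) (mapping_class_rel X)"
proof (rule equivI)
  show "mapping_class_rel X \<subseteq> homeos_plus X \<times> homeos_plus X"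
    by (auto simp: mapping_class_rel_def)
  show "refl_on (homeos_plus X) (mapping_class_rel X)"
    by (simp add: refl_on_def mapping_class_rel_def homeos_plus_def homeomorphic_imp_continuous_map)
  show "sym (mapping_class_rel X)"
    by (auto simp: sym_def mapping_class_rel_def intro: homotopic_with_symD)
  show "trans (mapping_class_rel X)"
    unfolding trans_def mapping_class_rel_def by (blast intro: homotopic_with_trans)
qed

lemma group_mapping_class_group: "Group.group (mapping_class_group X)"
  unfolding mapping_class_group_def
proof (rule quotient_monoid_group[OF equiv_mapping_class_rel])
  fix p p' q q' assume pq: "(p, p') \<in> mapping_class_rel X" "(q, q') \<in> mapping_class_rel X"
  then have "homotopic_with (\<lambda>h. True) X X (p \<circ> q) (p' \<circ> q')"
    by (auto simp: mapping_class_rel_def intro: homotopic_compose)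
  with pq show "(p \<circ> q, p' \<circ> q') \<in> mapping_class_rel X"
    by (simp add: mapping_class_rel_def homeos_plus_comp)
next
  show "id \<in> homeos_plus X" by (rule homeos_plus_id)
next
  have r: "(p, p) \<in> mapping_class_rel X" if "p \<in> homeos_plus X" for p
    using that by (simp add: mapping_class_rel_def homeos_plus_def homeomorphic_imp_continuous_map)
  fix p q s assume "p \<in> homeos_plus X" "q \<in> homeos_plus X" "s \<in> homeos_plus X"
  then show "(p \<circ> q \<circ> s, p \<circ> (q \<circ> s)) \<in> mapping_class_rel X"
    by (simp add: o_assoc r homeos_plus_comp)
next
  fix p assume p: "p \<in> homeos_plus X"
  then show "(id \<circ> p, p) \<in> mapping_class_rel X"
    by (simp add: mapping_class_rel_def homeos_plus_def homeomorphic_imp_continuous_map)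
  obtain q where q: "q \<in> homeos_plus X" "\<forall>x\<in>topspace X. q (p x) = x"
    using homeos_plus_inverse[OF p] by blast
  have "homotopic_with (\<lambda>h. True) X X (q \<circ> p) id"
    using q(2) by (intro homotopic_with_id2) auto
  with p q show "\<exists>q\<in>homeos_plus X. (q \<circ> p, id) \<in> mapping_class_rel X"
    by (auto simp: mapping_class_rel_def homeos_plus_comp homeos_plus_id intro!: bexI[of _ q])
qed

end

theory Submission
  imports Defs "HOL-Complex_Analysis.Winding_Numbers" "HOL-Algebra.Weak_Morphisms"
begin

text \<open>
  The surface is a Riemann surface spread over the plane, built like a Cayley graph. Take a sheet over
  the open upper half plane and a sheet over the open lower half plane for every element of \<open>G\<close>,
  and glue the upper sheet of \<open>g\<close> to the lower sheet of \<open>g \<otimes> t n\<close> along the \<open>n\<close>-th of a sequence of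
  disjoint open intervals of the real axis, where \<open>t\<close> is a sequence that takes every value in \<open>G\<close>
  infinitely often. Since every element occurs among the \<open>t n\<close>, any upper sheet is glued to any lower
  sheet, so the result is connected. Left multiplication permutes the sheets and commutes with the
  gluing, so \<open>G\<close> acts by deck transformations of the projection to the plane.

  The projection \<open>p\<close> is an open local homeomorphism, and this settles orientations: excision and \<open>p\<close>
  identify every local homology group with \<open>H\<^sub>2(\<complex>, \<complex> - {0})\<close>, an orientation is locally constant in
  these coordinates, hence constant because the surface is connected, and maps \<open>f\<close> with
  \<open>p \<circ> f = p\<close> do not change the coordinates (\<open>spread_orientable\<close> and
  \<open>deck_transformation_orientation_preserving\<close>).

  Everything else is detected by winding numbers. For every glued interval there is a map from the
  surface to \<open>\<complex> - {0}\<close> (\<open>edge_map\<close>) that counts signed crossings of this one interval: it equals \<open>1\<close>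
  far from the interval and runs once around the unit circle when the interval is crossed. If
  \<open>t n = t m\<close>, then a loop can go down through the \<open>n\<close>-th interval of an upper sheet and come back up
  through the \<open>m\<close>-th one. A nontrivial deck transformation moves this loop to other sheets, so it
  changes the winding number from \<open>1\<close> to \<open>0\<close> and cannot be homotopic to the identity; hence \<open>G\<close>
  embeds in the mapping class group. Using infinitely many \<open>n\<close> with the same \<open>m\<close> gives loops at
  one point on which infinitely many crossing numbers do not vanish, whereas a finite set of loops,
  being bounded, meets only finitely many intervals; hence the fundamental group is not finitely
  generated.
\<close>

section \<open>Local homology of the plane\<close>

lemma generator_of_iso:
  assumes f: "f \<in> iso A B" and A: "group A" and B: "group B"
    and a: "a \<in> carrier A" "generate A {a} = carrier A"
  shows "f a \<in> carrier B \<and> generate B {f a} = carrier B"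
proof -
  interpret group_hom A B f
    using f A B by (simp add: group_hom_def group_hom_axioms_def iso_def)
  have "f ` carrier A = carrier B" using f by (simp add: iso_def bij_betw_def)
  moreover have "generate B {f a} = f ` generate A {a}"
    using generate_img[of "{a}"] a by simp
  ultimately show ?thesis using a by auto
qed

lemma homotopic_with_linear_pair:
  fixes f g :: "'a::real_normed_vector \<Rightarrow> 'b::real_normed_vector"
  assumes f: "continuous_on UNIV f" and g: "continuous_on UNIV g"
    and ST: "\<And>w. w \<in> S \<Longrightarrow> closed_segment (f w) (g w) \<subseteq> T"
  shows "homotopic_with (\<lambda>h. h \<in> S \<rightarrow> T) euclidean euclidean f g"
proof -
  let ?h = "\<lambda>z. (1 - fst z) *\<^sub>R f (snd z) + fst z *\<^sub>R g (snd z)"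
  have "continuous_on ({0..1} \<times> UNIV) ?h"
    by (intro continuous_intros continuous_on_compose2[OF f] continuous_on_compose2[OF g]) auto
  then have "continuous_map (prod_topology (top_of_set {0..1}) (top_of_set UNIV)) euclidean ?h"
    unfolding prod_topology_subtopology_eu by simp
  moreover have "?h (t, w) \<in> T" if "t \<in> {0..1}" "w \<in> S" for t w
    using ST[OF that(2)] that(1) by (force simp: closed_segment_def)
  ultimately show ?thesis
    unfolding homotopic_with_def by (intro exI[of _ ?h]) auto
qed

text \<open>Moving \<open>y\<close> to \<open>z\<close> along the segment inside the disc homotopes one translation to the other, and
  points outside the disc never hit \<open>0\<close> on the way. So a class relative to the complement
  of a disc has the same image at every point of the disc, once points are compared by translation.\<close>

lemma local_homology_translation_invariant:
  assumes "y \<in> ball a r" "z \<in> ball a (r::real)"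
  shows "hom_induced 2 euclidean (- ball a r) euclidean (- {0}) (\<lambda>w. w - y :: complex) =
         hom_induced 2 euclidean (- ball a r) euclidean (- {0}) (\<lambda>w. w - z)"
proof (intro homology_homotopy_axiom homotopic_with_linear_pair continuous_intros)
  fix w assume w: "w \<in> - ball a r"
  have "0 \<notin> closed_segment (w - y) (w - z)"
  proof
    assume "0 \<in> closed_segment (w - y) (w - z)"
    then have "w \<in> closed_segment y z"
      by (force simp: closed_segment_def algebra_simps)
    then show False
      using closed_segment_subset[OF assms] w by auto
  qed
  then show "closed_segment (w - y) (w - z) \<subseteq> - {0}" by auto
qed

lemma contractible_space_complex: "contractible_space (euclidean :: complex topology)"
  using contractible_UNIV[where 'a=complex] contractible_space_top_of_set[of "UNIV :: complex set"] by simp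

text \<open>The punctured plane is homotopy equivalent to the unit circle, which is homeomorphic to
  \<open>nsphere 1\<close>.\<close>

lemma punctured_plane_homology_cyclic: "cyclic_group (reduced_homology_group 1 (top_of_set (- {0::complex})))"
proof -
  have "orthogonal 1 \<i>" by (simp add: orthogonal_def inner_complex_def)
  then have o: "pairwise orthogonal {1, \<i>}"
    by (auto simp: pairwise_def orthogonal_commute)
  have ind: "independent {1, \<i>}" by (rule pairwise_orthogonal_independent[OF o]) auto
  have sp: "span {1, \<i>} = UNIV"
    using ind by (intro dim_eq_full[THEN iffD1]) (simp add: dim_eq_card_independent)
  obtain f :: "(nat \<Rightarrow> real) \<Rightarrow> complex" and g where
    "homeomorphic_maps (nsphere (2 - 1)) (top_of_set (sphere 0 1 \<inter> span {1, \<i>})) f g"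
    by (rule homeomorphic_maps_nsphere_euclidean_sphere[OF ind o, of 2]) auto
  then have "nsphere 1 homeomorphic_space top_of_set (sphere (0::complex) 1)"
    unfolding sp by (auto simp: homeomorphic_space_def)
  then have 1: "reduced_homology_group 1 (nsphere 1) \<cong> reduced_homology_group 1 (top_of_set (sphere (0::complex) 1))"
    by (rule homeomorphic_space_imp_isomorphic_reduced_homology_groups)
  have "sphere (0::complex) 1 homotopy_eqv - {0::complex}"
  proof -
    have "0 \<in> rel_interior (cball (0::complex) 1)"
      by (simp add: rel_interior_nonempty_interior)
    then have "rel_frontier (cball (0::complex) 1) homotopy_eqv affine hull cball (0::complex) 1 - {0}"
      by (rule homotopy_eqv_rel_frontier_punctured_affine_hull[OF convex_cball bounded_cball])
    moreover have "affine hull cball (0::complex) 1 = UNIV"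
      by (rule affine_hull_nonempty_interior) simp
    ultimately show ?thesis
      by (simp only: rel_frontier_cball zero_neq_one if_False Compl_eq_Diff_UNIV one_neq_zero)
  qed
  then have 2: "reduced_homology_group 1 (top_of_set (sphere (0::complex) 1)) \<cong> reduced_homology_group 1 (top_of_set (- {0::complex}))"
    by (rule homotopy_equivalent_space_imp_isomorphic_reduced_homology_groups)
  show ?thesis
    using cyclic_reduced_homology_group_nsphere[of 1 1] isomorphic_group_cyclicity[OF iso_trans[OF 1 2]]
    by simp
qed

lemma boundary_iso: "S \<noteq> {} \<Longrightarrow> hom_boundary 2 euclidean S
  \<in> iso (relative_homology_group 2 euclidean S) (reduced_homology_group 1 (top_of_set (S :: complex set)))"
  using iso_relative_homology_of_contractible[OF contractible_space_complex, of S 2] by simp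

lemma local_homology_plane_generator:
  "\<exists>\<tau>\<in>carrier (relative_homology_group 2 euclidean (- {0::complex})).
     generate (relative_homology_group 2 euclidean (- {0::complex})) {\<tau>} =
     carrier (relative_homology_group 2 euclidean (- {0::complex}))"
    (is "\<exists>\<tau>\<in>carrier ?L. _ \<tau>")
proof -
  let ?R = "reduced_homology_group 1 (top_of_set (- {0::complex}))"
  have b: "inv_into (carrier ?L) (hom_boundary 2 euclidean (- {0})) \<in> iso ?R ?L"
    by (intro group.iso_set_sym boundary_iso) auto
  interpret group ?R by simp
  obtain a where a: "a \<in> carrier ?R" "subgroup_generated ?R {a} = ?R"
    using punctured_plane_homology_cyclic by (auto simp: cyclic_group_def)
  have "generate ?R {a} = carrier ?R"
    using arg_cong[OF a(2), of carrier] a(1) by (simp add: subgroup_generated_def Int_absorb1)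
  with generator_of_iso[OF b _ _ a(1)] show ?thesis by auto
qed

text \<open>Pushing points radially out of the disc is homotopy inverse to the inclusion of the complement of
  the disc in the punctured plane. As the plane is contractible, the boundary maps carry this
  equivalence to relative homology.\<close>

lemma local_homology_plane_extend:
  assumes r: "r > 0"
  shows "hom_induced 2 euclidean (- ball a r) euclidean (- {0::complex}) (\<lambda>w. w - a) `
    carrier (relative_homology_group 2 euclidean (- ball a r)) =
    carrier (relative_homology_group 2 euclidean (- {0}))"
proof -
  let ?h = "\<lambda>w. w - a"
  let ?k = "\<lambda>w. a + max 1 (r / norm w) *\<^sub>R w"
  let ?B = "- ball a r" let ?Z = "- {0::complex}"
  let ?L = "relative_homology_group 2 euclidean"
  have n: "norm (max 1 (r / norm w) *\<^sub>R w) \<ge> r" if "w \<noteq> 0" for w :: complex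
    using that r by (auto simp: max_def field_simps)
  have ne: "?B \<noteq> {}"
  proof -
    have "a + of_real r \<in> ?B" using r by (simp add: dist_norm)
    then show ?thesis by blast
  qed
  have cont: "continuous_on S ?h" "continuous_on ?Z ?k" for S
    by (auto intro!: continuous_intros)
  have K: "?k \<in> ?Z \<rightarrow> ?B"
    using n by (auto simp: dist_norm not_less)
  have H: "?h \<in> ?B \<rightarrow> ?Z" using r by auto
  \<comment> \<open>The segment from a point to its radial push stays away from the origin, so the straight-line
    homotopy does not leave the punctured plane.\<close>
  have seg: "closed_segment (max 1 (r / norm w) *\<^sub>R w) w \<subseteq> - ball 0 (if norm w < r then norm w else r)"
    if "w \<noteq> 0" for w :: complex
  proof
    fix x assume "x \<in> closed_segment (max 1 (r / norm w) *\<^sub>R w) w"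
    then obtain u where u: "0 \<le> u" "u \<le> 1" "x = ((1 - u) * max 1 (r / norm w) + u) *\<^sub>R w"
      by (auto simp: closed_segment_def scaleR_add_left)
    have "(1 - u) * max 1 (r / norm w) + u \<ge> (1 - u) * 1 + u"
      using u by (intro add_mono mult_left_mono) auto
    then have "norm x \<ge> norm w"
      using u mult_right_mono[of 1 "(1 - u) * max 1 (r / norm w) + u" "norm w"] by auto
    then show "x \<in> - ball 0 (if norm w < r then norm w else r)" by auto
  qed
  have "hom_induced 1 (top_of_set ?B) {} (top_of_set ?Z) {} ?h
    \<in> iso (reduced_homology_group 1 (top_of_set ?B)) (reduced_homology_group 1 (top_of_set ?Z))"
  proof (rule homotopy_equivalence_reduced_homology_group_isomorphism)
    show "continuous_map (top_of_set ?B) (top_of_set ?Z) ?h"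
      using cont H by (simp add: image_subset_iff_funcset)
    show "continuous_map (top_of_set ?Z) (top_of_set ?B) ?k"
      using cont K by (simp add: image_subset_iff_funcset)
    show "homotopic_with_canon (\<lambda>h. True) ?B ?B (?k \<circ> ?h) id"
    proof (rule homotopic_with_linear)
      show "continuous_on ?B (?k \<circ> ?h)"
        by (intro continuous_on_compose cont(1) continuous_on_subset[OF cont(2)]) (use r in auto)
      fix x assume "x \<in> ?B"
      then have x: "r \<le> norm (x - a)" "x - a \<noteq> 0" using r by (auto simp: dist_norm norm_minus_commute)
      then have "max 1 (r / norm (x - a)) = 1"
        using r by (simp add: max_def field_simps)
      then show "closed_segment ((?k \<circ> ?h) x) (id x) \<subseteq> ?B"
        using \<open>x \<in> ?B\<close> by simp
    qed simp
    show "homotopic_with_canon (\<lambda>h. True) ?Z ?Z (?h \<circ> ?k) id"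
    proof (rule homotopic_with_linear)
      show "continuous_on ?Z (?h \<circ> ?k)"
        by (auto intro!: continuous_intros simp: o_def)
      show "closed_segment ((?h \<circ> ?k) x) (id x) \<subseteq> ?Z" if "x \<in> ?Z" for x
        using seg[of x] that r by (auto split: if_splits)
    qed simp
  qed
  from iso_set_trans[OF boundary_iso[OF ne] this]
  have "bij_betw (hom_boundary 2 euclidean ?Z \<circ> hom_induced 2 euclidean ?B euclidean ?Z ?h)
    (carrier (?L ?B)) (carrier (reduced_homology_group 1 (top_of_set ?Z)))"
    using naturality_hom_induced[of euclidean euclidean ?h ?B ?Z 2] cont(1)[of UNIV] H by (simp add: iso_def)
  moreover have "bij_betw (hom_boundary 2 euclidean ?Z) (carrier (?L ?Z)) (carrier (reduced_homology_group 1 (top_of_set ?Z)))"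
    using boundary_iso[of ?Z] by (force simp: iso_def)
  ultimately have "bij_betw (hom_induced 2 euclidean ?B euclidean ?Z ?h) (carrier (?L ?B)) (carrier (?L ?Z))"
    using bij_betw_comp_iff2 hom_induced_carrier by (metis image_subsetI)
  then show ?thesis by (simp add: bij_betw_def)
qed


section \<open>Surfaces spread over the plane\<close>

text \<open>Excision of the complement of \<open>U\<close>: local homology at a part of \<open>U\<close> that stays away from the
  frontier of \<open>U\<close> can be computed inside \<open>U\<close>.\<close>

lemma excision_to_open_subset:
  assumes U: "openin X U" and K: "X closure_of K \<subseteq> U"
  shows "hom_induced q (subtopology X U) (U - K) X (topspace X - K) id
    \<in> iso (relative_homology_group q (subtopology X U) (U - K)) (relative_homology_group q X (topspace X - K))"
proof -
  have sub: "U \<subseteq> topspace X" using U by (rule openin_subset)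
  have "X closure_of (topspace X - U) = topspace X - U"
    using U by (intro closure_of_closedin) blast
  then have "X closure_of (topspace X - U) \<subseteq> X interior_of (topspace X - K)"
    using K by (auto simp: interior_of_complement)
  moreover have "topspace X - (topspace X - U) = U" "topspace X - K - (topspace X - U) = U - K"
    using sub by auto
  ultimately show ?thesis
    using homology_excision_axiom[of X "topspace X - U" "topspace X - K" "topspace X" q] by simp
qed

lemma iso_onto:
  assumes "f \<in> iso A B" "v \<in> carrier B"
  obtains u where "u \<in> carrier A" "v = f u"
  using assms by (auto simp: iso_def bij_betw_def)

lemma iso_inj:
  assumes "f \<in> iso A B" "u \<in> carrier A" "v \<in> carrier A" "f u = f v"
  shows "u = v"
  using assms by (auto simp: iso_def bij_betw_def inj_on_def)

lemma iso_factor: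
  assumes f: "f \<in> iso A B" and g: "g \<in> iso A C" and h: "\<And>a. a \<in> carrier A \<Longrightarrow> h (f a) = g a"
    and A: "group A" and B: "group B"
  shows "h \<in> iso B C"
proof (rule group.iso_eq[OF B])
  show "g \<circ> inv_into (carrier A) f \<in> iso B C"
    using iso_set_trans[OF group.iso_set_sym[OF A f] g] .
  have "f ` carrier A = carrier B" using f by (simp add: iso_def bij_betw_def)
  then show "h b = (g \<circ> inv_into (carrier A) f) b" if "b \<in> carrier B" for b
    using h that by (metis comp_def f_inv_into_f inv_into_into)
qed

text \<open>Spaces spread over the plane by a local homeomorphism \<open>p\<close>, as in the classical theory of
  Riemann surfaces.\<close>

locale spread_over_plane =
  fixes X :: "'a topology" and p :: "'a \<Rightarrow> complex"
  assumes Hausdorff: "Hausdorff_space X"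
    and cont: "continuous_map X euclidean p"
    and opn: "\<And>W. openin X W \<Longrightarrow> open (p ` W)"
    and locally_inj: "\<And>x. x \<in> topspace X \<Longrightarrow> \<exists>U. openin X U \<and> x \<in> U \<and> inj_on p U"
begin

definition sheet :: "'a set \<Rightarrow> bool" where
  "sheet U \<longleftrightarrow> openin X U \<and> inj_on p U"

lemma sheet_homeomorphic:
  assumes "sheet U"
  shows "homeomorphic_map (subtopology X U) (top_of_set (p ` U)) p"
proof (rule bijective_open_imp_homeomorphic_map)
  have U: "openin X U" "inj_on p U" using assms by (auto simp: sheet_def)
  have sub: "U \<subseteq> topspace X" using U(1) by (rule openin_subset)
  show "continuous_map (subtopology X U) (top_of_set (p ` U)) p"
    using cont sub by (auto simp: continuous_map_in_subtopology continuous_map_from_subtopology)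
  show "open_map (subtopology X U) (top_of_set (p ` U)) p"
    unfolding open_map_def
  proof (intro allI impI)
    fix W assume "openin (subtopology X U) W"
    then have "openin X W" "W \<subseteq> U"
      using U(1) by (auto simp: openin_open_subtopology)
    then show "openin (top_of_set (p ` U)) (p ` W)"
      using opn by (auto intro!: open_openin_trans opn[OF U(1)])
  qed
  show "p ` topspace (subtopology X U) = topspace (top_of_set (p ` U))"
    "inj_on p (topspace (subtopology X U))"
    using sub U(2) by (auto simp: Int_absorb1)
qed

text \<open>A homeomorphism onto \<open>p ` U\<close>, followed by excision in the plane.\<close>

lemma sheet_homology_iso:
  assumes U: "sheet U" and KU: "K \<subseteq> U" and cl: "closure (p ` K) \<subseteq> p ` U"
  shows "hom_induced 2 (subtopology X U) (U - K) euclidean (- p ` K) p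
    \<in> iso (relative_homology_group 2 (subtopology X U) (U - K)) (relative_homology_group 2 euclidean (- p ` K))"
proof -
  have oU: "openin X U" and inj: "inj_on p U" using U by (auto simp: sheet_def)
  have sub: "U \<subseteq> topspace X" using oU by (rule openin_subset)
  have im: "p ` (U - K) = p ` U - p ` K"
    using inj KU by (simp add: inj_on_image_set_diff)
  have 1: "hom_induced 2 (subtopology X U) (U - K) (top_of_set (p ` U)) (p ` U - p ` K) p
    \<in> iso (relative_homology_group 2 (subtopology X U) (U - K))
        (relative_homology_group 2 (top_of_set (p ` U)) (p ` U - p ` K))"
    using sub im by (intro homeomorphic_map_relative_homology_iso sheet_homeomorphic U) auto
  have 2: "hom_induced 2 (top_of_set (p ` U)) (p ` U - p ` K) euclidean (- p ` K) id
    \<in> iso (relative_homology_group 2 (top_of_set (p ` U)) (p ` U - p ` K))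
        (relative_homology_group 2 euclidean (- p ` K))"
    using excision_to_open_subset[of euclidean "p ` U" "p ` K" 2] opn[OF oU] cl
    by (simp add: Compl_eq_Diff_UNIV)
  have "hom_induced 2 (top_of_set (p ` U)) (p ` U - p ` K) euclidean (- p ` K) id \<circ>
     hom_induced 2 (subtopology X U) (U - K) (top_of_set (p ` U)) (p ` U - p ` K) p =
     hom_induced 2 (subtopology X U) (U - K) euclidean (- p ` K) (id \<circ> p)"
  proof (rule hom_induced_compose[symmetric])
    show "continuous_map (subtopology X U) (top_of_set (p ` U)) p"
      using sheet_homeomorphic[OF U] by (rule homeomorphic_imp_continuous_map)
    show "p \<in> (U - K) \<rightarrow> p ` U - p ` K" using im by blast
  qed auto
  then show ?thesis using iso_set_trans[OF 1 2] by simp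
qed

abbreviation incl :: "'a set \<Rightarrow> 'a set \<Rightarrow> 'a chain set \<Rightarrow> 'a chain set" where
  "incl U K \<equiv> hom_induced 2 (subtopology X U) (U - K) X (topspace X - K) id"

abbreviation proj :: "'a set \<Rightarrow> 'a set \<Rightarrow> complex \<Rightarrow> 'a chain set \<Rightarrow> complex chain set" where
  "proj U K z \<equiv> hom_induced 2 (subtopology X U) (U - K) euclidean (- {0}) (\<lambda>w. p w - z)"

abbreviation sheet_homology :: "'a set \<Rightarrow> 'a set \<Rightarrow> 'a chain set monoid" where
  "sheet_homology U K \<equiv> relative_homology_group 2 (subtopology X U) (U - K)"

abbreviation plane_homology :: "complex chain set monoid" where
  "plane_homology \<equiv> relative_homology_group 2 euclidean (- {0})"

lemma incl_iso:
  assumes "sheet U" "x \<in> U"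
  shows "incl U {x} \<in> iso (sheet_homology U {x}) (local_homology X {x})"
proof (rule excision_to_open_subset)
  show "openin X U" using assms by (simp add: sheet_def)
  have "x \<in> topspace X" using assms openin_subset by (force simp: sheet_def)
  then have "X closure_of {x} = {x}"
    using Hausdorff by (intro closure_of_closedin closedin_Hausdorff_singleton)
  then show "X closure_of {x} \<subseteq> U" using assms by simp
qed

lemma proj_iso:
  assumes U: "sheet U" "x \<in> U"
  shows "proj U {x} (p x) \<in> iso (sheet_homology U {x}) plane_homology"
proof -
  have 1: "hom_induced 2 (subtopology X U) (U - {x}) euclidean (- {p x}) p
    \<in> iso (sheet_homology U {x}) (relative_homology_group 2 euclidean (- {p x}))"
    using sheet_homology_iso[OF U(1), of "{x}"] U by simp
  have h: "homeomorphic_map euclidean euclidean (\<lambda>w. w - p x)"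
    unfolding homeomorphic_map_maps homeomorphic_maps_def
    by (rule exI[of _ "\<lambda>w. w + p x"]) (auto intro!: continuous_intros)
  have "hom_induced 2 euclidean (- {p x}) euclidean (- {0}) (\<lambda>w. w - p x)
    \<in> iso (relative_homology_group 2 euclidean (- {p x})) plane_homology"
    by (rule homeomorphic_map_relative_homology_iso[OF h]) (auto simp: image_iff algebra_simps intro: exI[of _ "_ + p x"])
  from iso_set_trans[OF 1 this]
  show ?thesis
  proof (subst (asm) hom_induced_compose[symmetric])
    show "p \<in> (U - {x}) \<rightarrow> - {p x}" using U by (auto simp: sheet_def inj_on_def)
  qed (use cont in \<open>auto simp: continuous_map_from_subtopology o_def intro!: continuous_intros\<close>)
qed

text \<open>The identification of the local homology group at \<open>x\<close> with that of the plane at the origin: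
  excise to a sheet, project, and translate \<open>p x\<close> to \<open>0\<close>. Any sheet around \<open>x\<close> may be used, and all
  give the same value (\<open>coord_incl\<close>).\<close>

definition coord :: "'a \<Rightarrow> 'a chain set \<Rightarrow> complex chain set" where
  "coord x u = (THE v. \<exists>U b. sheet U \<and> x \<in> U \<and> b \<in> carrier (sheet_homology U {x}) \<and>
     u = incl U {x} b \<and> v = proj U {x} (p x) b)"

text \<open>Passing to a smaller sheet does not change the result, so two sheets around \<open>x\<close> can be compared
  through their intersection.\<close>

lemma coord_shrink:
  assumes U: "sheet U" and V: "sheet V" "x \<in> V" "V \<subseteq> U"
    and b: "b \<in> carrier (sheet_homology U {x})" and c: "c \<in> carrier (sheet_homology V {x})"
    and eq: "incl U {x} b = incl V {x} c"
  shows "proj U {x} (p x) b = proj V {x} (p x) c"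
proof -
  let ?j = "hom_induced 2 (subtopology X V) (V - {x}) (subtopology X U) (U - {x}) id"
  have x: "x \<in> U" using V by blast
  have sub: "U \<subseteq> topspace X" using U openin_subset by (auto simp: sheet_def)
  have j: "continuous_map (subtopology X V) (subtopology X U) id" "id \<in> (V - {x}) \<rightarrow> (U - {x})"
    using V by (auto simp: continuous_map_in_subtopology continuous_map_from_subtopology)
  have i: "continuous_map (subtopology X U) X id" "id \<in> (U - {x}) \<rightarrow> topspace X - {x}"
    using sub by (auto simp: continuous_map_from_subtopology)
  have q: "continuous_map (subtopology X U) euclidean (\<lambda>w. p w - p x)"
      "(\<lambda>w. p w - p x) \<in> (U - {x}) \<rightarrow> - {0}"
    using U x cont by (auto simp: sheet_def inj_on_def continuous_map_from_subtopology intro!: continuous_intros)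
  have "incl U {x} (?j c) = incl V {x} c"
    using hom_induced_compose'[OF j i] by simp
  then have "incl U {x} (?j c) = incl U {x} b" using eq by simp
  moreover have "?j c \<in> carrier (sheet_homology U {x})" by (rule hom_induced_carrier)
  ultimately have "?j c = b"
    using iso_inj[OF incl_iso[OF U x]] b by blast
  moreover have "proj U {x} (p x) (?j c) = proj V {x} (p x) c"
    using hom_induced_compose'[OF j q] by (simp add: o_def)
  ultimately show ?thesis by simp
qed

lemma coord_incl:
  assumes U: "sheet U" "x \<in> U" and b: "b \<in> carrier (sheet_homology U {x})"
  shows "coord x (incl U {x} b) = proj U {x} (p x) b"
  unfolding coord_def
proof (rule the_equality)
  show "\<exists>U' b'. sheet U' \<and> x \<in> U' \<and> b' \<in> carrier (sheet_homology U' {x}) \<and>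
     incl U {x} b = incl U' {x} b' \<and> proj U {x} (p x) b = proj U' {x} (p x) b'"
    using assms by (intro exI[of _ U] exI[of _ b]) simp
next
  fix v assume "\<exists>U' b'. sheet U' \<and> x \<in> U' \<and> b' \<in> carrier (sheet_homology U' {x}) \<and>
     incl U {x} b = incl U' {x} b' \<and> v = proj U' {x} (p x) b'"
  then obtain U' b' where U': "sheet U'" "x \<in> U'" and b': "b' \<in> carrier (sheet_homology U' {x})"
    and eq: "incl U {x} b = incl U' {x} b'" and v: "v = proj U' {x} (p x) b'" by blast
  have V: "sheet (U \<inter> U')" "x \<in> U \<inter> U'"
    using U U' by (auto simp: sheet_def inj_on_def)
  have "incl U {x} b \<in> carrier (local_homology X {x})" by (rule hom_induced_carrier)
  then obtain c where c: "c \<in> carrier (sheet_homology (U \<inter> U') {x})" "incl U {x} b = incl (U \<inter> U') {x} c"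
    using iso_onto[OF incl_iso[OF V]] by metis
  show "v = proj U {x} (p x) b"
    unfolding v
    using coord_shrink[OF U(1) V _ b c(1)] coord_shrink[OF U'(1) V _ b' c(1)] c(2) eq by simp
qed

lemma coord_iso:
  assumes x: "x \<in> topspace X"
  shows "coord x \<in> iso (local_homology X {x}) plane_homology"
proof -
  obtain U where U: "sheet U" "x \<in> U" using locally_inj[OF x] by (auto simp: sheet_def)
  show ?thesis
    by (rule iso_factor[OF incl_iso[OF U] proj_iso[OF U] coord_incl[OF U]]) auto
qed

text \<open>The coordinates at all points \<open>y\<close> of \<open>K\<close> of one class relative to the complement of \<open>K\<close> come from a
  single class in the plane, and depend on \<open>y\<close> only through the final translation.\<close>

lemma coord_restrict:
  assumes U: "sheet U" and K: "y \<in> K" "K \<subseteq> U"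
  shows "coord y (hom_induced 2 X (topspace X - K) X (topspace X - {y}) id (incl U K b)) =
    hom_induced 2 euclidean (- p ` K) euclidean (- {0}) (\<lambda>w. w - p y)
      (hom_induced 2 (subtopology X U) (U - K) euclidean (- p ` K) p b)"
proof -
  have y: "y \<in> U" using K by blast
  have sub: "U \<subseteq> topspace X" using U openin_subset by (auto simp: sheet_def)
  have inj: "inj_on p U" using U by (simp add: sheet_def)
  let ?j = "hom_induced 2 (subtopology X U) (U - K) (subtopology X U) (U - {y}) id"
  have j: "continuous_map (subtopology X U) (subtopology X U) id" "id \<in> (U - K) \<rightarrow> (U - {y})"
    using K by auto
  have i: "continuous_map (subtopology X U) X id" "id \<in> (U - {y}) \<rightarrow> topspace X - {y}"
      "id \<in> (U - K) \<rightarrow> topspace X - K"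
    using sub by (auto simp: continuous_map_from_subtopology)
  have k: "continuous_map X X id" "id \<in> (topspace X - K) \<rightarrow> topspace X - {y}"
    using K by auto
  have cU: "continuous_map (subtopology X U) euclidean p"
    using cont by (rule continuous_map_from_subtopology)
  have q: "continuous_map (subtopology X U) euclidean (\<lambda>w. p w - p y)"
      "(\<lambda>w. p w - p y) \<in> (U - {y}) \<rightarrow> - {0}"
    using inj y cU by (auto simp: inj_on_def intro!: continuous_intros)
  have pK: "p \<in> (U - K) \<rightarrow> - p ` K"
    using inj K by (auto simp: inj_on_def)
  have t: "continuous_map euclidean euclidean (\<lambda>w. w - p y)" "(\<lambda>w. w - p y) \<in> (- p ` K) \<rightarrow> - {0}"
    using K by (auto intro!: continuous_intros)
  have "hom_induced 2 X (topspace X - K) X (topspace X - {y}) id (incl U K b) = incl U {y} (?j b)"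
    using hom_induced_compose'[OF i(1,3) k] hom_induced_compose'[OF j i(1,2)] by simp
  also have "coord y \<dots> = proj U {y} (p y) (?j b)"
    by (rule coord_incl[OF U y hom_induced_carrier])
  also have "\<dots> = hom_induced 2 euclidean (- p ` K) euclidean (- {0}) (\<lambda>w. w - p y)
      (hom_induced 2 (subtopology X U) (U - K) euclidean (- p ` K) p b)"
    using hom_induced_compose'[OF j q] hom_induced_compose'[OF cU pK t] by (simp add: o_def)
  finally show ?thesis .
qed

text \<open>Small discs in the plane lift to neighbourhoods whose closure stays inside a sheet: the lift of
  the closed disc is compact, hence closed. This is what excision needs.\<close>

lemma disc_neighbourhood:
  assumes W: "openin X W" "x \<in> W"
  obtains U K r where "sheet U" "openin X K" "x \<in> K" "K \<subseteq> U" "K \<subseteq> W" "r > 0"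
    "p ` K = ball (p x) r" "closure (p ` K) \<subseteq> p ` U" "X closure_of K \<subseteq> U"
proof -
  have "x \<in> topspace X" using W openin_subset by blast
  then obtain U0 where U0: "openin X U0" "x \<in> U0" "inj_on p U0" using locally_inj by blast
  define U where "U = U0 \<inter> W"
  have U: "sheet U" "x \<in> U" "openin X U" "inj_on p U" "U \<subseteq> W"
    using U0 W by (auto simp: U_def sheet_def inj_on_def)
  have sub: "U \<subseteq> topspace X" using U openin_subset by auto
  obtain r where r: "r > 0" "cball (p x) r \<subseteq> p ` U"
    using opn[OF U(3)] U(2) open_contains_cball by blast
  define K where "K = {w \<in> U. p w \<in> ball (p x) r}"
  define L where "L = {w \<in> U. p w \<in> cball (p x) r}"
  have pK: "p ` K = ball (p x) r"
    using r ball_subset_cball unfolding K_def by blast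
  have "openin X {w \<in> topspace X. p w \<in> ball (p x) r}"
    by (rule openin_continuous_map_preimage[OF cont]) simp
  moreover have "K = U \<inter> {w \<in> topspace X. p w \<in> ball (p x) r}"
    using sub by (auto simp: K_def)
  ultimately have oK: "openin X K" using U(3) openin_Int by metis
  obtain e where e: "homeomorphic_maps (subtopology X U) (top_of_set (p ` U)) p e"
    using sheet_homeomorphic[OF U(1)] by (auto simp: homeomorphic_map_maps)
  have ep: "e (p w) = w" if "w \<in> U" for w
    using e that sub by (auto simp: homeomorphic_maps_def)
  have "L = e ` cball (p x) r"
    using r(2) ep unfolding L_def by (force simp: image_iff)
  moreover have "compactin (top_of_set (p ` U)) (cball (p x) r)"
    using r by (simp add: compactin_subtopology)
  ultimately have "compactin (subtopology X U) L"
    using e image_compactin by (auto simp: homeomorphic_maps_def)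
  then have "closedin X L"
    using Hausdorff by (simp add: compactin_subtopology compactin_imp_closedin)
  then have "X closure_of K \<subseteq> L"
    by (rule closure_of_minimal[rotated]) (auto simp: K_def L_def)
  then have "X closure_of K \<subseteq> U" by (auto simp: L_def)
  moreover have "closure (p ` K) \<subseteq> p ` U" using pK r by simp
  ultimately show thesis
    using that[of U K r] U r pK oK by (auto simp: K_def)
qed

text \<open>Near \<open>x\<close> an orientation comes from one class relative to the complement of a disc, and such a class
  has the same coordinate at all points of the disc.\<close>

lemma orientation_coord_locally_constant:
  assumes \<mu>: "orientation X \<mu>" and x: "x \<in> topspace X"
  shows "\<exists>K. openin X K \<and> x \<in> K \<and> (\<forall>y\<in>K. coord y (\<mu> y) = coord x (\<mu> x))"
proof -
  obtain W c where W: "openin X W" "x \<in> W"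
    and c: "\<And>y. y \<in> W \<Longrightarrow> hom_induced 2 X (topspace X - W) X (topspace X - {y}) id c = \<mu> y"
    using \<mu> x unfolding orientation_def by metis
  obtain U K r where U: "sheet U" and K: "openin X K" "x \<in> K" "K \<subseteq> U" "K \<subseteq> W" and r: "r > 0"
    and pK: "p ` K = ball (p x) r" and cl: "X closure_of K \<subseteq> U"
    using disc_neighbourhood[OF W] by metis
  let ?c = "hom_induced 2 X (topspace X - W) X (topspace X - K) id c"
  have "?c \<in> carrier (local_homology X K)" by (rule hom_induced_carrier)
  moreover have "incl U K \<in> iso (sheet_homology U K) (local_homology X K)"
    using U cl by (intro excision_to_open_subset) (auto simp: sheet_def)
  ultimately obtain b where b: "?c = incl U K b"
    using iso_onto by metis
  have "coord y (\<mu> y) = hom_induced 2 euclidean (- ball (p x) r) euclidean (- {0}) (\<lambda>w. w - p x)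
      (hom_induced 2 (subtopology X U) (U - K) euclidean (- p ` K) p b)" if y: "y \<in> K" for y
  proof -
    have "\<mu> y = hom_induced 2 X (topspace X - W) X (topspace X - {y}) id c"
      using c y K by auto
    also have "\<dots> = hom_induced 2 X (topspace X - K) X (topspace X - {y}) id ?c"
    proof (subst hom_induced_compose')
      show "id \<in> (topspace X - W) \<rightarrow> topspace X - K" "id \<in> (topspace X - K) \<rightarrow> topspace X - {y}"
        using K y by auto
    qed auto
    finally have m: "\<mu> y = hom_induced 2 X (topspace X - K) X (topspace X - {y}) id (incl U K b)"
      using b by simp
    have "p x \<in> ball (p x) r" "p y \<in> ball (p x) r"
      using y K pK by blast+
    note t = local_homology_translation_invariant[OF this]
    show ?thesis
      unfolding m coord_restrict[OF U y K(3)] using t pK by simp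
  qed
  then show ?thesis using K by metis
qed

lemma orientation_coord_constant:
  assumes \<mu>: "orientation X \<mu>" and X: "connected_space X" and x: "x \<in> topspace X" "y \<in> topspace X"
  shows "coord x (\<mu> x) = coord y (\<mu> y)"
proof -
  let ?S = "{z \<in> topspace X. coord z (\<mu> z) = coord y (\<mu> y)}"
  let ?T = "{z \<in> topspace X. coord z (\<mu> z) \<noteq> coord y (\<mu> y)}"
  have op: "openin X {z \<in> topspace X. P (coord z (\<mu> z))}" for P
  proof (subst openin_subopen, clarify)
    fix z assume z: "z \<in> topspace X" "P (coord z (\<mu> z))"
    obtain K where K: "openin X K" "z \<in> K" "\<forall>y\<in>K. coord y (\<mu> y) = coord z (\<mu> z)"
      using orientation_coord_locally_constant[OF \<mu> z(1)] by blast
    have "K \<subseteq> topspace X" using K(1) by (rule openin_subset)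
    then have "K \<subseteq> {z \<in> topspace X. P (coord z (\<mu> z))}"
      using K(3) z(2) by (simp add: subset_eq)
    then show "\<exists>T. openin X T \<and> z \<in> T \<and> T \<subseteq> {z \<in> topspace X. P (coord z (\<mu> z))}"
      using K(1,2) by blast
  qed
  have S: "openin X ?S" and T: "openin X ?T" by (rule op)+
  have y: "y \<in> ?S" using x(2) by simp
  have "x \<notin> ?T"
  proof
    assume xT: "x \<in> ?T"
    have "topspace X \<subseteq> ?S \<union> ?T" "?S \<inter> ?T = {}" by auto
    moreover have "?S \<noteq> {}" "?T \<noteq> {}" using xT y by (metis empty_iff)+
    ultimately have "\<exists>E1 E2. openin X E1 \<and> openin X E2 \<and> topspace X \<subseteq> E1 \<union> E2 \<and> E1 \<inter> E2 = {} \<and> E1 \<noteq> {} \<and> E2 \<noteq> {}"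
      using S T by (intro exI[of _ ?S] exI[of _ ?T] conjI)
    then show False using X by (simp add: connected_space_def)
  qed
  then show ?thesis using x(1) by simp
qed

text \<open>Assign to every point the class whose coordinate is a fixed generator.\<close>

theorem spread_orientable: "orientable X"
proof -
  obtain \<tau> where \<tau>: "\<tau> \<in> carrier plane_homology" "generate plane_homology {\<tau>} = carrier plane_homology"
    using local_homology_plane_generator by blast
  define \<mu> where "\<mu> x = inv_into (carrier (local_homology X {x})) (coord x) \<tau>" for x
  have \<mu>: "\<mu> x \<in> carrier (local_homology X {x})" "coord x (\<mu> x) = \<tau>"
    "generate (local_homology X {x}) {\<mu> x} = carrier (local_homology X {x})" if "x \<in> topspace X" for x
  proof -
    have "\<tau> \<in> coord x ` carrier (local_homology X {x})"
      using coord_iso[OF that] \<tau>(1) by (simp add: iso_def bij_betw_def)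
    then show "\<mu> x \<in> carrier (local_homology X {x})" "coord x (\<mu> x) = \<tau>"
      unfolding \<mu>_def by (rule inv_into_into, rule f_inv_into_f)
    have "inv_into (carrier (local_homology X {x})) (coord x) \<in> iso plane_homology (local_homology X {x})"
      by (intro group.iso_set_sym coord_iso that) simp
    from generator_of_iso[OF this _ _ \<tau>]
    show "generate (local_homology X {x}) {\<mu> x} = carrier (local_homology X {x})"
      by (simp add: \<mu>_def)
  qed
  have "\<exists>K. openin X K \<and> x \<in> K \<and> (\<exists>c\<in>carrier (local_homology X K). \<forall>y\<in>K.
          hom_induced 2 X (topspace X - K) X (topspace X - {y}) id c = \<mu> y)" if x: "x \<in> topspace X" for x
  proof -
    obtain U K r where U: "sheet U" and K: "openin X K" "x \<in> K" "K \<subseteq> U" and r: "r > 0"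
      and pK: "p ` K = ball (p x) r" and cl: "closure (p ` K) \<subseteq> p ` U"
      using disc_neighbourhood[OF openin_topspace x] by metis
    have "\<tau> \<in> hom_induced 2 euclidean (- p ` K) euclidean (- {0}) (\<lambda>w. w - p x) `
        carrier (relative_homology_group 2 euclidean (- p ` K))"
      using local_homology_plane_extend[OF r, of "p x"] \<tau>(1) pK by simp
    then obtain d where d: "\<tau> = hom_induced 2 euclidean (- p ` K) euclidean (- {0}) (\<lambda>w. w - p x) d"
      "d \<in> carrier (relative_homology_group 2 euclidean (- p ` K))"
      by (rule imageE)
    obtain b where b: "hom_induced 2 (subtopology X U) (U - K) euclidean (- p ` K) p b = d"
      using iso_onto[OF sheet_homology_iso[OF U K(3) cl] d(2)] by metis
    have "hom_induced 2 X (topspace X - K) X (topspace X - {y}) id (incl U K b) = \<mu> y" if y: "y \<in> K" for y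
    proof -
      have yX: "y \<in> topspace X" using y K openin_subset by blast
      have "p x \<in> ball (p x) r" "p y \<in> ball (p x) r"
        using y K pK by blast+
      note t = local_homology_translation_invariant[OF this]
      have "coord y (hom_induced 2 X (topspace X - K) X (topspace X - {y}) id (incl U K b)) = coord y (\<mu> y)"
        unfolding coord_restrict[OF U y K(3)] \<mu>(2)[OF yX] d(1) b using t pK by simp
      then show ?thesis
        using iso_inj[OF coord_iso[OF yX] hom_induced_carrier \<mu>(1)[OF yX]] by blast
    qed
    then have "\<exists>c\<in>carrier (local_homology X K). \<forall>y\<in>K.
          hom_induced 2 X (topspace X - K) X (topspace X - {y}) id c = \<mu> y"
      by (intro bexI[of _ "incl U K b"] ballI hom_induced_carrier)
    then show ?thesis using K(1,2) by (intro exI[of _ K] conjI)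
  qed
  then have "orientation X \<mu>"
    unfolding orientation_def using \<mu> by simp
  then show ?thesis by (auto simp: orientable_def)
qed

text \<open>The map \<open>f\<close> carries a sheet around \<open>x\<close> to a sheet around \<open>f x\<close> with the same projection.\<close>

lemma coord_natural:
  assumes f: "homeomorphic_map X X f" and pf: "\<And>x. x \<in> topspace X \<Longrightarrow> p (f x) = p x"
    and x: "x \<in> topspace X" and u: "u \<in> carrier (local_homology X {x})"
  shows "coord (f x) (hom_induced 2 X (topspace X - {x}) X (topspace X - {f x}) f u) = coord x u"
proof -
  obtain U where U: "sheet U" "x \<in> U" using locally_inj[OF x] by (auto simp: sheet_def)
  have sub: "U \<subseteq> topspace X" using U openin_subset by (auto simp: sheet_def)
  have inj: "inj_on f (topspace X)" and cf: "continuous_map X X f"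
    using f by (auto simp: homeomorphic_eq_everything_map)
  have "openin X (f ` U)"
    using f U by (metis homeomorphic_map_openness sheet_def sub)
  moreover have "inj_on p (f ` U)"
    using U sub pf by (auto simp: sheet_def inj_on_def) (metis subsetD)
  ultimately have fU: "sheet (f ` U)" "f x \<in> f ` U" using U by (auto simp: sheet_def)
  have subf: "f ` U \<subseteq> topspace X" using fU openin_subset by (auto simp: sheet_def)
  obtain b where b: "b \<in> carrier (sheet_homology U {x})" "u = incl U {x} b"
    using iso_onto[OF incl_iso[OF U] u] by metis
  let ?f = "hom_induced 2 (subtopology X U) (U - {x}) (subtopology X (f ` U)) (f ` U - {f x}) f"
  have 1: "continuous_map (subtopology X U) (subtopology X (f ` U)) f" "f \<in> (U - {x}) \<rightarrow> f ` U - {f x}"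
    using cf inj sub U(2) by (auto simp: continuous_map_in_subtopology continuous_map_from_subtopology inj_on_def)
  have 2: "continuous_map (subtopology X (f ` U)) X id" "id \<in> (f ` U - {f x}) \<rightarrow> topspace X - {f x}"
    "continuous_map (subtopology X U) X id" "id \<in> (U - {x}) \<rightarrow> topspace X - {x}"
    using sub subf by (auto simp: continuous_map_from_subtopology)
  have 3: "f \<in> (topspace X - {x}) \<rightarrow> topspace X - {f x}"
    using cf inj x by (auto simp: continuous_map_def inj_on_def)
  have 4: "continuous_map (subtopology X (f ` U)) euclidean (\<lambda>w. p w - p (f x))"
      "(\<lambda>w. p w - p (f x)) \<in> (f ` U - {f x}) \<rightarrow> - {0}"
    using fU cont by (auto simp: sheet_def inj_on_def continuous_map_from_subtopology intro!: continuous_intros)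
  have "hom_induced 2 X (topspace X - {x}) X (topspace X - {f x}) f u = incl (f ` U) {f x} (?f b)"
    unfolding b(2) using hom_induced_compose'[OF 1 2(1,2)] hom_induced_compose'[OF 2(3,4) cf 3] by simp
  also have "coord (f x) \<dots> = proj (f ` U) {f x} (p (f x)) (?f b)"
    by (rule coord_incl[OF fU hom_induced_carrier])
  also have "\<dots> = hom_induced 2 (subtopology X U) (U - {x}) euclidean (- {0}) (\<lambda>w. p (f w) - p (f x)) b"
    unfolding hom_induced_compose'[OF 1 4] by (simp only: o_def)
  also have "\<dots> = proj U {x} (p x) b"
  proof (rule fun_cong[OF hom_induced_eq])
    fix w assume "w \<in> topspace (subtopology X U)"
    then have "w \<in> topspace X" by simp
    then show "p (f w) - p (f x) = p w - p x" using pf x by simp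
  qed
  also have "\<dots> = coord x u"
    using coord_incl[OF U b(1)] b(2) by simp
  finally show ?thesis .
qed

text \<open>By connectedness an orientation has the same coordinate at \<open>x\<close> and at \<open>f x\<close>, and \<open>f\<close> preserves
  coordinates.\<close>

theorem deck_transformation_orientation_preserving:
  assumes X: "connected_space X" and f: "homeomorphic_map X X f"
    and pf: "\<And>x. x \<in> topspace X \<Longrightarrow> p (f x) = p x"
  shows "f \<in> homeos_plus X"
  unfolding homeos_plus_def orientation_preserving_def
proof (intro CollectI conjI allI impI ballI f)
  fix \<mu> x assume \<mu>: "orientation X \<mu>" and x: "x \<in> topspace X"
  have fx: "f x \<in> topspace X" using f x by (auto simp: homeomorphic_eq_everything_map)
  have \<mu>c: "\<mu> y \<in> carrier (local_homology X {y})" if "y \<in> topspace X" for y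
    using \<mu> that by (auto simp: orientation_def)
  have "coord (f x) (hom_induced 2 X (topspace X - {x}) X (topspace X - {f x}) f (\<mu> x)) = coord (f x) (\<mu> (f x))"
    using coord_natural[OF f pf x \<mu>c[OF x]] orientation_coord_constant[OF \<mu> X x fx] by simp
  then show "hom_induced 2 X (topspace X - {x}) X (topspace X - {f x}) f (\<mu> x) = \<mu> (f x)"
    using iso_inj[OF coord_iso[OF fx] hom_induced_carrier \<mu>c[OF fx]] by blast
qed

end

lemma (in spread_over_plane) spread_surface:
  assumes "second_countable X" shows "surface X"
  unfolding surface_def
proof (intro conjI ballI Hausdorff assms)
  fix x assume x: "x \<in> topspace X"
  then obtain U where U: "sheet U" "x \<in> U" using locally_inj by (auto simp: sheet_def)
  obtain f :: "complex \<Rightarrow> real^2" and g where fg: "linear f" "linear g" "\<And>x. g (f x) = x" "\<And>y. f (g y) = y"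
    by (rule isomorphisms_UNIV_UNIV[where 'M=complex and 'N="real^2"]) auto
  have "open (p ` U)" using U opn by (simp add: sheet_def)
  moreover have "bij f" using fg by (metis bij_betw_def injI surjI)
  ultimately have "open (f ` p ` U)"
    using open_bijective_linear_image_eq[OF fg(1)] by blast
  moreover have "subtopology X U homeomorphic_space top_of_set (p ` U)"
    using sheet_homeomorphic[OF U(1)] by (rule homeomorphic_map_imp_homeomorphic_space)
  moreover have "continuous_on (p ` U) f" "continuous_on (f ` p ` U) g"
    using fg(1,2) linear_conv_bounded_linear linear_continuous_on by metis+
  then have "homeomorphism (p ` U) (f ` p ` U) f g"
    unfolding homeomorphism_def using fg(3,4) by (simp add: image_image)
  then have "top_of_set (p ` U) homeomorphic_space top_of_set (f ` p ` U)"
    by (auto simp: homeomorphic_def)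
  ultimately show "\<exists>U (V :: (real^2) set).
       openin X U \<and> x \<in> U \<and> open V \<and> subtopology X U homeomorphic_space top_of_set V"
    using U homeomorphic_space_trans unfolding sheet_def by blast
qed


section \<open>Winding numbers of loops and homotopy\<close>

lemma pathin_loop_join:
  assumes p: "pathin X p" and q: "pathin X q" and pq: "p 1 = q 0"
  shows "pathin X (loop_join p q)"
proof -
  let ?I = "top_of_set {0..1::real}"
  have A: "continuous_map (subtopology ?I {z. z \<in> topspace ?I \<and> z \<le> 1/2}) X (p \<circ> (\<lambda>t. 2 * t))"
    by (rule continuous_map_compose[OF _ p[unfolded pathin_def]],
        unfold subtopology_subtopology continuous_map_subtopology_eu) (auto intro!: continuous_intros)
  have B: "continuous_map (subtopology ?I {z. z \<in> topspace ?I \<and> 1/2 \<le> z}) X (q \<circ> (\<lambda>t. 2 * t - 1))"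
    by (rule continuous_map_compose[OF _ q[unfolded pathin_def]],
        unfold subtopology_subtopology continuous_map_subtopology_eu) (auto intro!: continuous_intros)
  have id: "continuous_map ?I euclideanreal (\<lambda>t. t)" by simp
  have "continuous_map ?I X (\<lambda>t. if t \<le> 1/2 then (p \<circ> (\<lambda>t. 2 * t)) t else (q \<circ> (\<lambda>t. 2 * t - 1)) t)"
  proof (rule continuous_map_cases_le[OF id _ A B])
    fix t :: real assume "t = 1/2"
    then have "2 * t = 1" "2 * t - 1 = 0" by auto
    then show "(p \<circ> (\<lambda>t. 2 * t)) t = (q \<circ> (\<lambda>t. 2 * t - 1)) t" using pq by (simp only: o_def)
  qed simp
  then show ?thesis unfolding pathin_def loop_join_def by (simp only: o_def)
qed

lemma path_compose_pathin:
  assumes "continuous_map X (top_of_set (- {0::complex})) \<phi>" "pathin X p"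
  shows "path (\<phi> \<circ> p)" "path_image (\<phi> \<circ> p) \<subseteq> - {0}" "0 \<notin> path_image (\<phi> \<circ> p)"
proof -
  have "continuous_map (top_of_set {0..1}) (top_of_set (- {0})) (\<phi> \<circ> p)"
    using assms unfolding pathin_def by (intro continuous_map_compose)
  then show "path (\<phi> \<circ> p)" "path_image (\<phi> \<circ> p) \<subseteq> - {0}"
    by (auto simp: path_def path_image_def)
  then show "0 \<notin> path_image (\<phi> \<circ> p)" by auto
qed

lemma winding_number_loop_join:
  assumes \<phi>: "continuous_map X (top_of_set (- {0::complex})) \<phi>"
    and p: "pathin X p" and q: "pathin X q" and pq: "p 1 = q 0"
  shows "winding_number (\<phi> \<circ> loop_join p q) 0 = winding_number (\<phi> \<circ> p) 0 + winding_number (\<phi> \<circ> q) 0"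
proof -
  have "\<phi> \<circ> loop_join p q = (\<phi> \<circ> p) +++ (\<phi> \<circ> q)"
    by (auto simp: loop_join_def joinpaths_def)
  then show ?thesis
    using path_compose_pathin[OF \<phi> p] path_compose_pathin[OF \<phi> q] pq
    by (simp add: winding_number_join pathfinish_def pathstart_def)
qed

lemma winding_number_loop_homotopy:
  assumes \<phi>: "continuous_map X (top_of_set (- {0::complex})) \<phi>" and pq: "(p, q) \<in> loop_homotopy X a"
  shows "winding_number (\<phi> \<circ> p) 0 = winding_number (\<phi> \<circ> q) 0"
proof (rule winding_number_homotopic_paths)
  have "homotopic_with (\<lambda>r. r 0 = a \<and> r 1 = a) (top_of_set {0..1}) X p q"
    using pq by (simp add: loop_homotopy_def)
  then have "homotopic_with (\<lambda>r. r 0 = \<phi> a \<and> r 1 = \<phi> a) (top_of_set {0..1}) (top_of_set (- {0})) (\<phi> \<circ> p) (\<phi> \<circ> q)"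
    using \<phi> by (rule homotopic_with_compose_continuous_map_left) auto
  moreover have "p 0 = a" "p 1 = a"
    using equiv_loop_homotopy[of X a] pq by (auto simp: equiv_def loops_def)
  ultimately show "homotopic_paths (- {0}) (\<phi> \<circ> p) (\<phi> \<circ> q)"
    unfolding homotopic_paths_def pathstart_def pathfinish_def by simp
qed

text \<open>A homotopy from \<open>f\<close> to the identity moves the loop \<open>f \<circ> p\<close> freely to \<open>p\<close>, and the base
  point does not matter for the winding number.\<close>

lemma not_homotopic_id:
  assumes \<phi>: "continuous_map X (top_of_set (- {0::complex})) \<phi>"
    and p: "pathin X p" "p 0 = p 1"
    and ne: "winding_number (\<phi> \<circ> f \<circ> p) 0 \<noteq> winding_number (\<phi> \<circ> p) 0"
  shows "\<not> homotopic_with (\<lambda>h. True) X X f id"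
proof
  assume "homotopic_with (\<lambda>h. True) X X f id"
  then have "homotopic_with (\<lambda>r. r 0 = r 1) (top_of_set {0..1}) X (f \<circ> p) (id \<circ> p)"
    using p(1) unfolding pathin_def by (rule homotopic_with_compose_continuous_map_right) (use p(2) in auto)
  then have "homotopic_with (\<lambda>r. r 0 = r 1) (top_of_set {0..1}) (top_of_set (- {0})) (\<phi> \<circ> (f \<circ> p)) (\<phi> \<circ> (id \<circ> p))"
    using \<phi> by (rule homotopic_with_compose_continuous_map_left) auto
  then have "homotopic_loops (- {0}) (\<phi> \<circ> f \<circ> p) (\<phi> \<circ> p)"
    unfolding homotopic_loops_def pathstart_def pathfinish_def by (simp add: o_assoc eq_commute)
  then show False using ne winding_number_homotopic_loops by blast
qed

text \<open>Winding numbers of \<open>\<phi> n \<circ> p\<close> define homomorphisms from the fundamental group to the additive group of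
  complex numbers. Finitely many generators are killed by all but finitely many of them, so only
  finitely many could be nonzero if the group were finitely generated.\<close>

lemma not_finitely_generated_fundamental_group:
  fixes \<phi> :: "'i \<Rightarrow> 'a \<Rightarrow> complex"
  assumes a: "a \<in> topspace X"
    and \<phi>: "\<And>n. continuous_map X (top_of_set (- {0})) (\<phi> n)"
    and fin: "\<And>p. p \<in> loops X a \<Longrightarrow> finite {n. winding_number (\<phi> n \<circ> p) 0 \<noteq> 0}"
    and inf: "infinite {n. \<exists>p\<in>loops X a. winding_number (\<phi> n \<circ> p) 0 \<noteq> 0}"
  shows "\<not> finitely_generated_group (fundamental_group X a)"
proof
  let ?G = "fundamental_group X a" let ?r = "loop_homotopy X a"
  let ?w = "\<lambda>n p. winding_number (\<phi> n \<circ> p) 0"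
  interpret group ?G using a by (rule group_fundamental_group)
  have E: "equiv (loops X a) ?r" by (rule equiv_loop_homotopy)
  have carr: "carrier ?G = loops X a // ?r" by (simp add: fundamental_group_def)
  assume "finitely_generated_group ?G"
  then obtain A where A: "A \<subseteq> carrier ?G" "finite A" "generate ?G A = carrier ?G"
    by (auto simp: finitely_generated_group_def)
  have "\<exists>p. p \<in> loops X a \<and> P = ?r `` {p}" if "P \<in> A" for P
    using that A(1) unfolding carr by (auto elim!: quotientE)
  then obtain rep where rep: "\<And>P. P \<in> A \<Longrightarrow> rep P \<in> loops X a \<and> P = ?r `` {rep P}" by metis
  define I where "I = {n. \<exists>p\<in>loops X a. ?w n p \<noteq> 0}"
  define B where "B = (\<Union>P\<in>A. {n. ?w n (rep P) \<noteq> 0})"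
  have "finite B" unfolding B_def using A(2) fin rep by (intro finite_UN_I) auto
  then have "infinite (I - B)" using inf unfolding I_def[symmetric] by (rule Diff_infinite_finite)
  then have "I - B \<noteq> {}" by (rule infinite_imp_nonempty)
  then obtain n where "n \<in> I" "n \<notin> B" by blast
  then have n: "\<And>P. P \<in> A \<Longrightarrow> ?w n (rep P) = 0" "\<exists>p\<in>loops X a. ?w n p \<noteq> 0"
    unfolding I_def B_def by blast+
  have invariant: "?w n p = ?w n q" if "(p, q) \<in> ?r" for p q
    using \<phi> that by (rule winding_number_loop_homotopy)
  have in_loops: "p \<in> loops X a" if "P \<in> carrier ?G" "p \<in> P" for p P
    using that E unfolding carr by (auto elim!: quotientE simp: equiv_def)
  have join: "?w n (loop_join p q) = ?w n p + ?w n q" if "p \<in> loops X a" "q \<in> loops X a" for p q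
    using that by (intro winding_number_loop_join[OF \<phi>]) (auto simp: loops_def)
  have gen: "?w n p = 0" if p: "P \<in> A" "p \<in> P" for p P
  proof -
    have "(rep P, p) \<in> ?r" using p rep by blast
    then show ?thesis using invariant n(1)[OF p(1)] by metis
  qed
  have const: "?w n (\<lambda>t. a) = 0"
  proof -
    have "\<phi> n \<circ> (\<lambda>t. a) = linepath (\<phi> n a) (\<phi> n a)" by (auto simp: linepath_def scaleR_left_distrib[symmetric])
    moreover have "\<phi> n a \<noteq> 0" using \<phi>[of n] a by (auto simp: continuous_map_def)
    ultimately show ?thesis by simp
  qed
  have one_w: "?w n p = 0" if "p \<in> one ?G" for p
    using that invariant[of "\<lambda>t. a" p] const by (simp add: fundamental_group_def)
  have "\<forall>p\<in>P. ?w n p = 0" if "P \<in> generate ?G A" for P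
    using that
  proof (induction rule: generate.induct)
    case (inv P)
    then have P: "P \<in> carrier ?G" using A by auto
    show ?case
    proof
      fix q assume q: "q \<in> inv\<^bsub>?G\<^esub> P"
      have qc: "inv\<^bsub>?G\<^esub> P \<in> carrier ?G" using P by simp
      obtain p where p: "p \<in> P" "p \<in> loops X a"
        using rep[OF inv] E by (metis equiv_class_self)
      have ql: "q \<in> loops X a" using in_loops[OF qc q] .
      have "(loop_join q p, loop_join q p) \<in> ?r"
        using loop_join_loops[OF ql p(2)] E by (auto simp: equiv_def refl_on_def)
      then have "loop_join q p \<in> inv\<^bsub>?G\<^esub> P \<otimes>\<^bsub>?G\<^esub> P"
        unfolding fundamental_group_def using q p(1) by (auto simp: fundamental_group_def)
      then have "?w n (loop_join q p) = 0" using one_w l_inv[OF P] by simp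
      then show "?w n q = 0" using join[OF ql p(2)] gen[OF inv p(1)] by simp
    qed
  next
    case (eng P Q)
    show ?case
    proof
      have c: "P \<in> carrier ?G" "Q \<in> carrier ?G" using eng A by auto
      fix s assume "s \<in> P \<otimes>\<^bsub>?G\<^esub> Q"
      then obtain p q where pq: "p \<in> P" "q \<in> Q" "(loop_join p q, s) \<in> ?r"
        by (auto simp: fundamental_group_def)
      then show "?w n s = 0"
        using invariant[OF pq(3)] join[OF in_loops[OF c(1) pq(1)] in_loops[OF c(2) pq(2)]] eng by simp
    qed
  next
    case one
    show ?case using one_w by blast
  next
    case (incl P)
    then show ?case using gen by blast
  qed
  moreover obtain p where p: "p \<in> loops X a" "?w n p \<noteq> 0" using n(2) by blast
  moreover have "?r `` {p} \<in> generate ?G A" unfolding A(3) carr using p(1) by (rule quotientI)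
  moreover have "p \<in> ?r `` {p}" using E p(1) by (rule equiv_class_self)
  ultimately show False by blast
qed


section \<open>Group actions and the mapping class group\<close>

lemma mapping_class_group_mult:
  assumes f: "f \<in> homeos_plus X" and g: "g \<in> homeos_plus X"
  shows "mapping_class_rel X `` {f} \<otimes>\<^bsub>mapping_class_group X\<^esub> mapping_class_rel X `` {g} = mapping_class_rel X `` {f \<circ> g}"
proof -
  note E = equiv_mapping_class_rel[of X]
  have "(\<Union>p\<in>mapping_class_rel X `` {f}. \<Union>q\<in>mapping_class_rel X `` {g}. mapping_class_rel X `` {p \<circ> q}) =
    mapping_class_rel X `` {f \<circ> g}"
  proof (rule UN_equiv_class2[OF E E _ f g])
    have "(p \<circ> q, p' \<circ> q') \<in> mapping_class_rel X"
      if "(p, p') \<in> mapping_class_rel X" "(q, q') \<in> mapping_class_rel X" for p p' q q'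
      using that by (auto simp: mapping_class_rel_def homeos_plus_comp intro: homotopic_compose)
    then show "congruent2 (mapping_class_rel X) (mapping_class_rel X) (\<lambda>p q. mapping_class_rel X `` {p \<circ> q})"
      by (auto simp: congruent2_def intro!: equiv_class_eq[OF E])
  qed
  then show ?thesis by (simp add: mapping_class_group_def)
qed

lemma action_embeds_in_mapping_class_group:
  assumes G: "group G" and d: "\<And>k. k \<in> carrier G \<Longrightarrow> d k \<in> homeos_plus X"
    and dd: "\<And>k l x. k \<in> carrier G \<Longrightarrow> l \<in> carrier G \<Longrightarrow> x \<in> topspace X \<Longrightarrow> d (k \<otimes>\<^bsub>G\<^esub> l) x = d k (d l x)"
    and nt: "\<And>k. k \<in> carrier G \<Longrightarrow> k \<noteq> \<one>\<^bsub>G\<^esub> \<Longrightarrow> \<not> homotopic_with (\<lambda>h. True) X X (d k) id"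
  shows "\<exists>H. subgroup H (mapping_class_group X) \<and> G \<cong> (mapping_class_group X)\<lparr>carrier := H\<rparr>"
proof -
  let ?M = "mapping_class_group X" let ?r = "mapping_class_rel X"
  let ?c = "\<lambda>k. ?r `` {d k}"
  note E = equiv_mapping_class_rel[of X]
  have mult: "?c (k \<otimes>\<^bsub>G\<^esub> l) = ?c k \<otimes>\<^bsub>?M\<^esub> ?c l" if k: "k \<in> carrier G" and l: "l \<in> carrier G" for k l
  proof -
    have kl: "k \<otimes>\<^bsub>G\<^esub> l \<in> carrier G" using G k l by (simp add: group.is_monoid monoid.m_closed)
    have "continuous_map X X (d (k \<otimes>\<^bsub>G\<^esub> l))"
      using d[OF kl] by (simp add: homeos_plus_def homeomorphic_imp_continuous_map)
    then have "homotopic_with (\<lambda>h. True) X X (d (k \<otimes>\<^bsub>G\<^esub> l)) (d k \<circ> d l)"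
      by (intro homotopic_with_equal) (auto simp: dd k l)
    then have "(d (k \<otimes>\<^bsub>G\<^esub> l), d k \<circ> d l) \<in> ?r"
      using d kl k l by (simp add: mapping_class_rel_def homeos_plus_comp)
    then show ?thesis
      using mapping_class_group_mult[OF d[OF k] d[OF l]] equiv_class_eq[OF E] by simp
  qed
  have carr: "?c k \<in> carrier ?M" if "k \<in> carrier G" for k
    using d[OF that] by (simp add: mapping_class_group_def quotientI)
  interpret group_hom G ?M ?c
    using G group_mapping_class_group[of X] carr mult
    by (auto simp: group_hom_def group_hom_axioms_def hom_def)
  have ker: "k = \<one>\<^bsub>G\<^esub>" if k: "k \<in> carrier G" "?c k = \<one>\<^bsub>?M\<^esub>" for k
  proof -
    have "?r `` {d k} = ?r `` {id}" using k(2) by (simp add: mapping_class_group_def)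
    then have "(d k, id) \<in> ?r" using eq_equiv_class[OF _ E homeos_plus_id] by blast
    then show ?thesis using nt[OF k(1)] by (auto simp: mapping_class_rel_def)
  qed
  have "kernel G ?M ?c = {\<one>\<^bsub>G\<^esub>}"
  proof (intro equalityI subsetI)
    show "k \<in> {\<one>\<^bsub>G\<^esub>}" if "k \<in> kernel G ?M ?c" for k
      using that ker by (simp add: kernel_def)
    show "k \<in> kernel G ?M ?c" if "k \<in> {\<one>\<^bsub>G\<^esub>}" for k
      using that hom_one by (simp add: kernel_def)
  qed
  then have inj: "inj_on ?c (carrier G)" by (simp only: inj_iff_trivial_ker)
  have "?c \<in> iso G (?M\<lparr>carrier := ?c ` carrier G\<rparr>)"
    using inj mult by (auto simp: iso_def hom_def bij_betw_def)
  then show ?thesis using img_is_subgroup is_isoI by blast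
qed


section \<open>The surface of a group with a sequence of elements\<close>

text \<open>The sequence \<open>t\<close> lists the gluing data: \<open>t n\<close> is the group element picked up when the \<open>n\<close>-th
  interval is crossed from above. That values repeat makes loops possible; that they repeat
  infinitely often makes the fundamental group large.\<close>

locale cayley_surface = group G for G (structure) +
  fixes t :: "nat \<Rightarrow> 'a"
  assumes t_carrier: "t n \<in> carrier G"
    and t_infinite: "g \<in> carrier G \<Longrightarrow> infinite {n. t n = g}"
begin

text \<open>The plane without the part of the real axis outside the \<open>n\<close>-th interval, which is centred at
  the integer \<open>n\<close> and has length \<open>1\<close>.\<close>

definition slit_plane :: "nat \<Rightarrow> complex set" where
  "slit_plane n = {z. Im z \<noteq> 0 \<or> \<bar>Re z - real n\<bar> < 1/2}"

text \<open>The lift of the \<open>n\<close>-th slit plane that contains the upper sheet of \<open>g\<close>. The points of the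
  intervals themselves are counted as part of the upper sheet.\<close>

definition chart :: "nat \<Rightarrow> 'a \<Rightarrow> complex \<Rightarrow> 'a \<times> complex" where
  "chart n g z = (if 0 \<le> Im z then g else g \<otimes> t n, z)"

definition points :: "('a \<times> complex) set" where
  "points = carrier G \<times> (\<Union>n. slit_plane n)"

definition S :: "('a \<times> complex) topology" where
  "S = topology (\<lambda>W. W \<subseteq> points \<and> (\<forall>n. \<forall>g\<in>carrier G. open {z \<in> slit_plane n. chart n g z \<in> W}))"

lemma slit_plane_memI: "Im z \<noteq> 0 \<Longrightarrow> z \<in> slit_plane n"
  by (simp add: slit_plane_def)

lemma open_slit_plane: "open (slit_plane n)"
  unfolding slit_plane_def by (intro open_Collect_disj open_Collect_neq open_Collect_less continuous_intros)

lemma openin_S: "openin S W \<longleftrightarrow> W \<subseteq> points \<and> (\<forall>n. \<forall>g\<in>carrier G. open {z \<in> slit_plane n. chart n g z \<in> W})"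
proof -
  have "istopology (\<lambda>W. W \<subseteq> points \<and> (\<forall>n. \<forall>g\<in>carrier G. open {z \<in> slit_plane n. chart n g z \<in> W}))"
    unfolding istopology_def
  proof (intro conjI allI impI ballI; (elim conjE)?)
    fix A B n g
    assume "\<forall>n. \<forall>g\<in>carrier G. open {z \<in> slit_plane n. chart n g z \<in> A}"
      "\<forall>n. \<forall>g\<in>carrier G. open {z \<in> slit_plane n. chart n g z \<in> B}" and g: "g \<in> carrier G"
    then have "open ({z \<in> slit_plane n. chart n g z \<in> A} \<inter> {z \<in> slit_plane n. chart n g z \<in> B})"
      by (intro open_Int) auto
    also have "{z \<in> slit_plane n. chart n g z \<in> A} \<inter> {z \<in> slit_plane n. chart n g z \<in> B} =
      {z \<in> slit_plane n. chart n g z \<in> A \<inter> B}" by auto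
    finally show "open {z \<in> slit_plane n. chart n g z \<in> A \<inter> B}" .
  next
    fix \<K> n g
    assume K: "\<forall>K\<in>\<K>. K \<subseteq> points \<and> (\<forall>n. \<forall>g\<in>carrier G. open {z \<in> slit_plane n. chart n g z \<in> K})"
      and g: "g \<in> carrier G"
    then have "open (\<Union>K\<in>\<K>. {z \<in> slit_plane n. chart n g z \<in> K})" by (intro open_UN) auto
    also have "(\<Union>K\<in>\<K>. {z \<in> slit_plane n. chart n g z \<in> K}) = {z \<in> slit_plane n. chart n g z \<in> \<Union>\<K>}"
      by auto
    finally show "open {z \<in> slit_plane n. chart n g z \<in> \<Union>\<K>}" .
  qed auto
  then show ?thesis unfolding S_def by (simp add: topology_inverse')
qed

lemma snd_chart [simp]: "snd (chart n g z) = z"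
  by (simp add: chart_def)

lemma chart_in: "g \<in> carrier G \<Longrightarrow> z \<in> slit_plane n \<Longrightarrow> chart n g z \<in> points"
  using t_carrier by (auto simp: chart_def points_def)

lemma topspace_S: "topspace S = points"
proof -
  have "openin S points"
    using open_slit_plane chart_in by (auto simp: openin_S cong: conj_cong)
  moreover have "\<And>W. openin S W \<Longrightarrow> W \<subseteq> points" by (simp add: openin_S)
  ultimately show ?thesis by (meson openin_subset openin_topspace subset_antisym)
qed

lemma points_in_slit_plane:
  assumes "x \<in> points" obtains n where "snd x \<in> slit_plane n"
proof -
  have "\<exists>n. snd x \<in> slit_plane n" using assms by (cases x) (auto simp: points_def)
  then show thesis using that by blast
qed

lemma chart_cover:
  assumes "x \<in> points" "snd x \<in> slit_plane n"
  obtains g where "g \<in> carrier G" "x = chart n g (snd x)"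
proof -
  obtain h z where x: "x = (h, z)" "h \<in> carrier G" using assms by (auto simp: points_def)
  let ?g = "if 0 \<le> Im z then h else h \<otimes> inv (t n)"
  have "?g \<in> carrier G" "x = chart n ?g (snd x)"
    using x t_carrier by (auto simp: chart_def m_assoc)
  then show thesis by (rule that)
qed

lemma chart_eq_iff:
  assumes "g \<in> carrier G" "h \<in> carrier G"
  shows "chart n g z = chart n h w \<longleftrightarrow> z = w \<and> g = h"
  using assms t_carrier by (auto simp: chart_def)

lemma chart_image_preimage:
  "{z \<in> A. chart m h z \<in> chart n g ` W} = {z \<in> A \<inter> W. chart m h z = chart n g z}"
  by (auto simp: chart_def)

text \<open>Charts with the same \<open>n\<close> have equal or disjoint images, and charts with different \<open>n\<close> meet only
  over half planes, where they agree or are disjoint.\<close>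

lemma chart_open:
  assumes W: "open W" "W \<subseteq> slit_plane n" and g: "g \<in> carrier G"
  shows "openin S (chart n g ` W)"
  unfolding openin_S
proof (intro conjI allI ballI)
  show "chart n g ` W \<subseteq> points" using chart_in[OF g] W by auto
  fix m h assume h: "h \<in> carrier G"
  show "open {z \<in> slit_plane m. chart m h z \<in> chart n g ` W}"
  proof (cases "m = n")
    case True
    then have "{z \<in> slit_plane m. chart m h z \<in> chart n g ` W} = (if h = g then W else {})"
      unfolding chart_image_preimage using W by (auto simp: chart_eq_iff[OF h g])
    then show ?thesis using W by simp
  next
    case False
    have "Im z \<noteq> 0" if "z \<in> slit_plane m" "z \<in> slit_plane n" for z
    proof
      assume "Im z = 0"
      then have "\<bar>Re z - real m\<bar> < 1/2" "\<bar>Re z - real n\<bar> < 1/2" using that by (auto simp: slit_plane_def)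
      then have "\<bar>real m - real n\<bar> < 1" by linarith
      then show False using False by linarith
    qed
    then have "{z \<in> slit_plane m. chart m h z \<in> chart n g ` W} = slit_plane m \<inter> W \<inter>
        ((if h = g then {z. 0 < Im z} else {}) \<union> (if h \<otimes> t m = g \<otimes> t n then {z. Im z < 0} else {}))"
      unfolding chart_image_preimage using W(2) by (force simp: chart_def)
    then show ?thesis
      using W open_slit_plane open_halfspace_Im_gt[of 0] open_halfspace_Im_lt[of 0]
      by (auto intro!: open_Int open_Un)
  qed
qed

lemma continuous_map_chart:
  assumes "g \<in> carrier G"
  shows "continuous_map (top_of_set (slit_plane n)) S (chart n g)"
  unfolding continuous_map_alt
proof (intro conjI allI impI)
  fix W assume "openin S W"
  then have "open {z \<in> slit_plane n. chart n g z \<in> W}" using assms by (simp add: openin_S)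
  moreover have "chart n g -` W \<inter> topspace (top_of_set (slit_plane n)) = {z \<in> slit_plane n. chart n g z \<in> W}" by auto
  ultimately show "openin (top_of_set (slit_plane n)) (chart n g -` W \<inter> topspace (top_of_set (slit_plane n)))"
    using open_slit_plane[of n] by (auto simp: openin_open_eq)
qed (use assms chart_in in \<open>auto simp: topspace_S\<close>)

lemma continuous_map_from_S:
  assumes "\<And>n g. g \<in> carrier G \<Longrightarrow> continuous_map (top_of_set (slit_plane n)) Y (\<lambda>z. f (chart n g z))"
  shows "continuous_map S Y f"
  unfolding continuous_map_alt
proof (intro conjI allI impI)
  fix W assume W: "openin Y W"
  show "openin S (f -` W \<inter> topspace S)"
    unfolding openin_S
  proof (intro conjI allI ballI)
    fix n g assume g: "g \<in> carrier G"
    have "openin (top_of_set (slit_plane n)) {z \<in> slit_plane n. f (chart n g z) \<in> W}"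
      using openin_continuous_map_preimage[OF assms[OF g, of n] W] by simp
    moreover have "{z \<in> slit_plane n. f (chart n g z) \<in> W} = {z \<in> slit_plane n. chart n g z \<in> f -` W \<inter> topspace S}"
      using chart_in[OF g] by (auto simp: topspace_S)
    ultimately show "open {z \<in> slit_plane n. chart n g z \<in> f -` W \<inter> topspace S}"
      using open_slit_plane[of n] by (auto simp: openin_open_eq)
  qed (auto simp: topspace_S)
next
  show "f \<in> topspace S \<rightarrow> topspace Y"
  proof
    fix x assume x: "x \<in> topspace S"
    then have xp: "x \<in> points" by (simp add: topspace_S)
    then obtain n where n: "snd x \<in> slit_plane n" by (rule points_in_slit_plane)
    with x obtain g where g: "g \<in> carrier G" "x = chart n g (snd x)"
      using chart_cover[of x n] by (metis topspace_S)
    have "f (chart n g (snd x)) \<in> topspace Y"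
      using assms[OF g(1), of n] n by (auto simp: continuous_map_def Pi_iff)
    then show "f x \<in> topspace Y" using g(2) by simp
  qed
qed

lemma continuous_map_snd_S: "continuous_map S euclidean snd"
  by (rule continuous_map_from_S) (simp add: continuous_on_id)

lemma snd_image_open:
  assumes "openin S W" shows "open (snd ` W)"
proof -
  have "snd ` W = (\<Union>n. \<Union>g\<in>carrier G. {z \<in> slit_plane n. chart n g z \<in> W})"
  proof (intro equalityI subsetI)
    fix z assume "z \<in> snd ` W"
    then obtain x where x: "x \<in> W" "z = snd x" by auto
    then have xp: "x \<in> points" using assms by (auto simp: openin_S)
    then obtain n where n: "snd x \<in> slit_plane n" by (rule points_in_slit_plane)
    obtain g where g: "g \<in> carrier G" "x = chart n g (snd x)" using chart_cover[OF xp n] .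
    have "chart n g z \<in> W" using x g by metis
    then show "z \<in> (\<Union>n. \<Union>g\<in>carrier G. {z \<in> slit_plane n. chart n g z \<in> W})"
      using x(2) n g(1) by blast
  next
    fix z assume "z \<in> (\<Union>n. \<Union>g\<in>carrier G. {z \<in> slit_plane n. chart n g z \<in> W})"
    then obtain n g where "chart n g z \<in> W" by auto
    then show "z \<in> snd ` W" by (metis image_eqI snd_chart)
  qed
  moreover have "open (\<Union>n. \<Union>g\<in>carrier G. {z \<in> slit_plane n. chart n g z \<in> W})"
    using assms by (intro open_UN ballI) (simp add: openin_S)
  ultimately show ?thesis by simp
qed

lemma Hausdorff_S: "Hausdorff_space S"
  unfolding Hausdorff_space_def
proof (intro allI impI)
  fix x y assume "x \<in> topspace S \<and> y \<in> topspace S \<and> x \<noteq> y"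
  then have xy: "x \<in> points" "y \<in> points" "x \<noteq> y" by (auto simp: topspace_S)
  show "\<exists>U V. openin S U \<and> openin S V \<and> x \<in> U \<and> y \<in> V \<and> disjnt U V"
  proof (cases "snd x = snd y")
    case True
    obtain n where n: "snd x \<in> slit_plane n" using points_in_slit_plane[OF xy(1)] .
    obtain g where g: "g \<in> carrier G" "x = chart n g (snd x)" using chart_cover[OF xy(1) n] .
    obtain h where h: "h \<in> carrier G" "y = chart n h (snd x)" using chart_cover[OF xy(2)] n True by metis
    have "g \<noteq> h" using g h xy by auto
    then have "disjnt (chart n g ` slit_plane n) (chart n h ` slit_plane n)"
      unfolding disjnt_iff using chart_eq_iff[OF g(1) h(1)] by (metis imageE)
    moreover have "x \<in> chart n g ` slit_plane n" "y \<in> chart n h ` slit_plane n"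
      using g h n by auto
    ultimately show ?thesis using chart_open[OF open_slit_plane subset_refl] g h by blast
  next
    case False
    then obtain A B where AB: "open A" "open B" "snd x \<in> A" "snd y \<in> B" "A \<inter> B = {}"
      using separation_t2[of "snd x" "snd y"] by auto
    have "openin S {w \<in> topspace S. snd w \<in> A}" "openin S {w \<in> topspace S. snd w \<in> B}"
      using AB by (auto intro!: openin_continuous_map_preimage[OF continuous_map_snd_S])
    moreover have "disjnt {w \<in> topspace S. snd w \<in> A} {w \<in> topspace S. snd w \<in> B}"
      using AB by (auto simp: disjnt_def)
    moreover have "x \<in> {w \<in> topspace S. snd w \<in> A}" "y \<in> {w \<in> topspace S. snd w \<in> B}"
      using xy AB by (auto simp: topspace_S)
    ultimately show ?thesis by blast
  qed
qed

sublocale spread_over_plane S snd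
proof
  fix x assume "x \<in> topspace S"
  then have x: "x \<in> points" by (simp add: topspace_S)
  then obtain n where n: "snd x \<in> slit_plane n" by (rule points_in_slit_plane)
  obtain g where g: "g \<in> carrier G" "x = chart n g (snd x)" using chart_cover[OF x n] .
  have "inj_on snd (chart n g ` slit_plane n)" by (rule inj_on_imageI) (simp add: o_def inj_on_def)
  moreover have "x \<in> chart n g ` slit_plane n" using g n by auto
  ultimately show "\<exists>U. openin S U \<and> x \<in> U \<and> inj_on snd U"
    using chart_open[OF open_slit_plane subset_refl g(1)] by blast
qed (simp_all add: Hausdorff_S continuous_map_snd_S snd_image_open)

lemma countable_carrier: "countable (carrier G)"
proof -
  have "carrier G \<subseteq> range t"
  proof
    fix g assume "g \<in> carrier G"
    then have "{n. t n = g} \<noteq> {}" using t_infinite by (metis finite.emptyI)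
    then show "g \<in> range t" by auto
  qed
  then show ?thesis using countable_subset by blast
qed

lemma second_countable_S: "second_countable S"
proof -
  obtain B :: "complex set set" where B: "countable B" "topological_basis B"
    using ex_countable_basis by blast
  let ?B = "(\<lambda>(n, g, b). chart n g ` (b \<inter> slit_plane n)) ` (UNIV \<times> carrier G \<times> B)"
  define \<B> where "\<B> = ?B"
  have "countable \<B>" using B(1) countable_carrier unfolding \<B>_def by blast
  moreover have "openin S V" if "V \<in> \<B>" for V
    using that[unfolded \<B>_def] topological_basis_open[OF B(2)] open_slit_plane by (auto intro!: chart_open open_Int)
  moreover have "\<exists>V\<in>\<B>. x \<in> V \<and> V \<subseteq> U" if U: "openin S U" "x \<in> U" for x U
  proof -
    have x: "x \<in> points" using U by (auto simp: openin_S)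
    then obtain n where n: "snd x \<in> slit_plane n" by (rule points_in_slit_plane)
    obtain g where g: "g \<in> carrier G" "x = chart n g (snd x)" using chart_cover[OF x n] .
    have "open {z \<in> slit_plane n. chart n g z \<in> U}" using U g by (auto simp: openin_S)
    moreover have "snd x \<in> {z \<in> slit_plane n. chart n g z \<in> U}" using g n U by simp
    ultimately obtain b where b: "b \<in> B" "snd x \<in> b" "b \<subseteq> {z \<in> slit_plane n. chart n g z \<in> U}"
      by (rule topological_basisE[OF B(2)])
    have "x \<in> chart n g ` (b \<inter> slit_plane n)" using g n b by auto
    moreover have "chart n g ` (b \<inter> slit_plane n) \<subseteq> U" using b by auto
    moreover have "chart n g ` (b \<inter> slit_plane n) \<in> \<B>" using b g unfolding \<B>_def by force
    ultimately show ?thesis by (intro bexI[of _ "chart n g ` (b \<inter> slit_plane n)"] conjI)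
  qed
  ultimately show ?thesis unfolding second_countable_def by blast
qed

lemma connected_slit_plane: "connected (slit_plane n)"
proof (rule starlike_imp_connected)
  let ?c = "complex_of_real (real n)"
  have "closed_segment ?c z \<subseteq> slit_plane n" if z: "z \<in> slit_plane n" for z
  proof
    fix w assume "w \<in> closed_segment ?c z"
    then obtain u where u: "0 \<le> u" "u \<le> 1" "w = (1 - u) *\<^sub>R ?c + u *\<^sub>R z" by (auto simp: closed_segment_def)
    have re: "Re w - real n = u * (Re z - real n)" and im: "Im w = u * Im z"
      unfolding u(3) by (simp_all add: algebra_simps)
    show "w \<in> slit_plane n"
    proof (cases "Im w = 0")
      case True
      then have "\<bar>Re z - real n\<bar> < 1/2 \<or> u = 0" using z im by (auto simp: slit_plane_def)
      moreover have "u * \<bar>Re z - real n\<bar> \<le> 1 * \<bar>Re z - real n\<bar>" using u by (intro mult_right_mono) auto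
      ultimately have "\<bar>Re w - real n\<bar> < 1/2" using u unfolding re by (auto simp: abs_mult)
      then show ?thesis by (simp add: slit_plane_def)
    qed (simp add: slit_plane_def)
  qed
  moreover have "?c \<in> slit_plane n" by (simp add: slit_plane_def)
  ultimately show "starlike (slit_plane n)" unfolding starlike_def by blast
qed

text \<open>The lifts of all slit planes that contain the upper sheet of \<open>g\<close> form a connected set. It contains
  the lower sheet of \<open>\<one>\<close>, because \<open>inv g\<close> is one of the \<open>t n\<close>, so all these sets meet.\<close>

lemma connected_S: "connected_space S"
proof -
  have chart: "connectedin S (chart n g ` slit_plane n)" if "g \<in> carrier G" for n g
    using connectedin_continuous_map_image[OF continuous_map_chart[OF that, of n], of "slit_plane n"]
      connected_slit_plane[of n] by (simp add: connectedin_subtopology)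
  define A where "A g = (\<Union>n. chart n g ` slit_plane n)" for g
  have A: "connectedin S (A g)" if "g \<in> carrier G" for g
    unfolding A_def
  proof (rule connectedin_Union)
    show "\<And>B. B \<in> range (\<lambda>n. chart n g ` slit_plane n) \<Longrightarrow> connectedin S B" using chart[OF that] by auto
    have "(g, \<i>) \<in> chart n g ` slit_plane n" for n
      by (rule image_eqI[of _ _ \<i>]) (auto simp: chart_def slit_plane_def)
    then show "\<Inter> (range (\<lambda>n. chart n g ` slit_plane n)) \<noteq> {}" by blast
  qed
  have "connectedin S (\<Union>g\<in>carrier G. A g)"
  proof (rule connectedin_Union)
    show "\<And>B. B \<in> A ` carrier G \<Longrightarrow> connectedin S B" using A by auto
    have "(\<one>, - \<i>) \<in> A g" if g: "g \<in> carrier G" for g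
    proof -
      have "{n. t n = inv g} \<noteq> {}" using t_infinite[of "inv g"] g by (metis finite.emptyI inv_closed)
      then obtain n where "t n = inv g" by auto
      then have "(\<one>, - \<i>) = chart n g (- \<i>)" using g by (simp add: chart_def)
      then show ?thesis unfolding A_def using slit_plane_memI[of "- \<i>" n] by auto
    qed
    then show "\<Inter> (A ` carrier G) \<noteq> {}" by blast
  qed
  moreover have "(\<Union>g\<in>carrier G. A g) = topspace S"
  proof
    show "(\<Union>g\<in>carrier G. A g) \<subseteq> topspace S" using chart_in by (auto simp: A_def topspace_S)
    show "topspace S \<subseteq> (\<Union>g\<in>carrier G. A g)"
    proof
      fix x assume "x \<in> topspace S"
      then have x: "x \<in> points" by (simp add: topspace_S)
      then obtain n where n: "snd x \<in> slit_plane n" by (rule points_in_slit_plane)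
      obtain g where "g \<in> carrier G" "x = chart n g (snd x)" using chart_cover[OF x n] .
      then show "x \<in> (\<Union>g\<in>carrier G. A g)" using n unfolding A_def by blast
    qed
  qed
  ultimately show ?thesis by (simp add: connectedin_topspace)
qed


section \<open>The group acts by deck transformations\<close>

definition deck :: "'a \<Rightarrow> 'a \<times> complex \<Rightarrow> 'a \<times> complex" where
  "deck k x = (k \<otimes> fst x, snd x)"

lemma deck_chart: "k \<in> carrier G \<Longrightarrow> g \<in> carrier G \<Longrightarrow> deck k (chart n g z) = chart n (k \<otimes> g) z"
  using t_carrier by (simp add: deck_def chart_def m_assoc)

lemma deck_deck: "k \<in> carrier G \<Longrightarrow> l \<in> carrier G \<Longrightarrow> x \<in> topspace S \<Longrightarrow> deck k (deck l x) = deck (k \<otimes> l) x"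
  by (auto simp: deck_def topspace_S points_def m_assoc)

lemma deck_one: "x \<in> topspace S \<Longrightarrow> deck \<one> x = x"
  by (auto simp: deck_def topspace_S points_def)

lemma continuous_map_deck:
  assumes "k \<in> carrier G" shows "continuous_map S S (deck k)"
  using assms by (intro continuous_map_from_S) (simp add: deck_chart continuous_map_chart)

lemma deck_homeos_plus:
  assumes k: "k \<in> carrier G" shows "deck k \<in> homeos_plus S"
proof (rule deck_transformation_orientation_preserving[OF connected_S])
  have "homeomorphic_maps S S (deck k) (deck (inv k))"
    unfolding homeomorphic_maps_def using k
    by (simp add: continuous_map_deck deck_deck deck_one)
  then show "homeomorphic_map S S (deck k)" by (auto simp: homeomorphic_map_maps)
qed (simp add: deck_def)


section \<open>Counting crossings of one interval\<close>

definition strip :: "nat \<Rightarrow> complex set" where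
  "strip n = {z. \<bar>Re z - real n\<bar> < 1/2}"

text \<open>The argument of the exponential is \<open>2 * pi * \<i>\<close> times a number that grows from \<open>0\<close> to \<open>1\<close>
  as \<open>z\<close> descends through the square with the \<open>n\<close>-th interval as diagonal. Above and below
  the square the maximum is \<open>\<bar>Im z\<bar>\<close>, so that number is constantly \<open>0\<close> or \<open>1\<close> and the value is \<open>1\<close>. On
  the \<open>n\<close>-th slit plane the maximum is positive, so this is continuous there.\<close>

definition bump :: "nat \<Rightarrow> complex \<Rightarrow> complex" where
  "bump n z = exp (2 * of_real pi * \<i> * of_real ((1 - Im z / max (1/2 - \<bar>Re z - real n\<bar>) \<bar>Im z\<bar>) / 2))"

text \<open>The interval of the upper sheet of \<open>h\<close> with number \<open>n\<close> is singled out: \<open>bump n\<close> is used on the lift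
  of the \<open>n\<close>-th strip that contains it, and everything else is sent to \<open>1\<close>.\<close>

definition edge_map :: "nat \<Rightarrow> 'a \<Rightarrow> 'a \<times> complex \<Rightarrow> complex" where
  "edge_map n h x = (if x \<in> chart n h ` strip n then bump n (snd x) else 1)"

lemma bump_eq_1:
  assumes "Im z \<noteq> 0" "1/2 - \<bar>Re z - real n\<bar> \<le> \<bar>Im z\<bar>"
  shows "bump n z = 1"
proof -
  have m: "max (1/2 - \<bar>Re z - real n\<bar>) \<bar>Im z\<bar> = \<bar>Im z\<bar>" using assms by simp
  show ?thesis
  proof (cases "Im z > 0")
    case True
    then show ?thesis unfolding bump_def m by simp
  next
    case False
    then have "Im z < 0" using assms by simp
    then have q: "(1 - Im z / \<bar>Im z\<bar>) / 2 = 1" by (simp add: abs_if)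
    show ?thesis unfolding bump_def m q by simp
  qed
qed

lemma bump_outside_strip:
  assumes "Im z \<noteq> 0" "z \<notin> strip n"
  shows "bump n z = 1"
proof (rule bump_eq_1[OF assms(1)])
  show "1/2 - \<bar>Re z - real n\<bar> \<le> \<bar>Im z\<bar>"
    using assms(2) abs_ge_zero[of "Im z"] unfolding strip_def mem_Collect_eq by linarith
qed

lemma continuous_on_bump: "continuous_on (slit_plane n) (bump n)"
proof -
  have "0 < max (1/2 - \<bar>Re z - real n\<bar>) \<bar>Im z\<bar>" if "z \<in> slit_plane n" for z
    using that by (auto simp: slit_plane_def less_max_iff_disj)
  then have nz: "max (1/2 - \<bar>Re z - real n\<bar>) \<bar>Im z\<bar> \<noteq> 0" if "z \<in> slit_plane n" for z
    using that by (metis less_irrefl)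
  show ?thesis unfolding bump_def by (intro continuous_intros ballI; (erule nz | simp))
qed

lemma strip_subset: "strip n \<subseteq> slit_plane n"
  by (auto simp: strip_def slit_plane_def)

lemma strip_disjoint: "z \<in> strip n \<Longrightarrow> z \<in> strip m \<Longrightarrow> m = n"
proof (rule ccontr)
  assume "z \<in> strip n" "z \<in> strip m" "m \<noteq> n"
  then have "\<bar>real m - real n\<bar> < 1" unfolding strip_def mem_Collect_eq by linarith
  with \<open>m \<noteq> n\<close> show False by linarith
qed

lemma edge_map_outside_strip: "snd x \<notin> strip n \<Longrightarrow> edge_map n h x = 1"
  by (auto simp: edge_map_def)

lemma edge_map_chart:
  assumes "g \<in> carrier G" "h \<in> carrier G" "z \<in> slit_plane n"
  shows "edge_map n h (chart n g z) = (if g = h then bump n z else 1)"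
proof -
  have "chart n g z \<in> chart n h ` strip n \<longleftrightarrow> g = h \<and> z \<in> strip n"
    using chart_eq_iff[OF assms(1,2)] by (auto simp: image_iff)
  moreover have "bump n z = 1" if "z \<notin> strip n"
    using that assms(3) by (intro bump_outside_strip) (auto simp: slit_plane_def strip_def)
  ultimately show ?thesis by (simp add: edge_map_def)
qed

lemma edge_map_chart_off_axis:
  assumes "Im z \<noteq> 0"
  shows "edge_map n h (chart m g z) = (if chart m g z = chart n h z then bump n z else 1)"
proof -
  have "chart m g z \<in> chart n h ` strip n \<longleftrightarrow> chart m g z = chart n h z \<and> z \<in> strip n"
    by (auto simp: chart_def)
  then show ?thesis using bump_outside_strip[OF assms] by (auto simp: edge_map_def)
qed

text \<open>In a chart with the same number \<open>n\<close> the map is \<open>bump n\<close> or constant. In a chart with another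
  number \<open>m\<close> it is so on each half plane, and it is \<open>1\<close> around the \<open>m\<close>-th interval, which the
  \<open>n\<close>-th strip does not meet.\<close>

lemma continuous_map_edge_map:
  assumes h: "h \<in> carrier G"
  shows "continuous_map S (top_of_set (- {0})) (edge_map n h)"
proof (rule continuous_map_from_S)
  fix m g assume g: "g \<in> carrier G"
  have nz: "edge_map n h x \<noteq> 0" for x by (simp add: edge_map_def bump_def)
  have "continuous_on (slit_plane m) (\<lambda>z. edge_map n h (chart m g z))"
  proof (cases "m = n")
    case True
    have "continuous_on (slit_plane n) (\<lambda>z. if g = h then bump n z else 1)"
      using continuous_on_bump by (cases "g = h") simp_all
    then show ?thesis
      unfolding True by (rule continuous_on_eq) (simp add: edge_map_chart g h)
  next
    case False
    have b: "continuous_on A (\<lambda>z. if c then bump n z else 1)" if "\<And>z. z \<in> A \<Longrightarrow> Im z \<noteq> 0" for A c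
      using continuous_on_subset[OF continuous_on_bump, of A n] that slit_plane_memI
      by (cases c) auto
    let ?P = "{z. 0 < Im z}" and ?N = "{z. Im z < 0}"
    have 1: "continuous_on ?P (\<lambda>z. edge_map n h (chart m g z))"
    proof (rule continuous_on_eq)
      show "continuous_on ?P (\<lambda>z. if g = h then bump n z else 1)"
        by (rule b) auto
      show "(if g = h then bump n z else 1) = edge_map n h (chart m g z)" if "z \<in> ?P" for z
        using that edge_map_chart_off_axis[of z n h m g] by (simp add: chart_def)
    qed
    have 2: "continuous_on ?N (\<lambda>z. edge_map n h (chart m g z))"
    proof (rule continuous_on_eq)
      show "continuous_on ?N (\<lambda>z. if g \<otimes> t m = h \<otimes> t n then bump n z else 1)"
        by (rule b) auto
      show "(if g \<otimes> t m = h \<otimes> t n then bump n z else 1) = edge_map n h (chart m g z)" if "z \<in> ?N" for z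
        using that edge_map_chart_off_axis[of z n h m g] by (simp add: chart_def)
    qed
    have 3: "continuous_on (strip m) (\<lambda>z. edge_map n h (chart m g z))"
    proof (rule continuous_on_eq)
      show "continuous_on (strip m) (\<lambda>z. 1 :: complex)" by simp
      show "1 = edge_map n h (chart m g z)" if "z \<in> strip m" for z
        using strip_disjoint[OF that] False by (metis edge_map_outside_strip snd_chart)
    qed
    have "open (strip m)" unfolding strip_def by (intro open_Collect_less continuous_intros)
    then have "continuous_on ((?P \<union> ?N) \<union> strip m) (\<lambda>z. edge_map n h (chart m g z))"
      using 1 2 3 by (intro continuous_on_open_Un open_Un open_halfspace_Im_gt open_halfspace_Im_lt)
    moreover have "slit_plane m = (?P \<union> ?N) \<union> strip m"
      by (auto simp: slit_plane_def strip_def)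
    ultimately show ?thesis by simp
  qed
  then show "continuous_map (top_of_set (slit_plane m)) (top_of_set (- {0})) (\<lambda>z. edge_map n h (chart m g z))"
    using nz by auto
qed


section \<open>Loops through two intervals\<close>

definition upper :: "nat \<Rightarrow> complex" where "upper n = Complex (real n) (1/2)"
definition lower :: "nat \<Rightarrow> complex" where "lower n = Complex (real n) (-1/2)"

definition descent :: "nat \<Rightarrow> nat \<Rightarrow> real \<Rightarrow> complex" where
  "descent n m = linepath (upper m) (upper n) +++ (linepath (upper n) (lower n) +++ linepath (lower n) (lower m))"

text \<open>Down through the \<open>n\<close>-th interval and back up through the \<open>m\<close>-th one. It closes up on the surface
  when \<open>t n = t m\<close>. Only the descent depends on \<open>n\<close>, so that all these loops share a base point
  for fixed \<open>h\<close> and \<open>m\<close>.\<close>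

definition edge_loop :: "'a \<Rightarrow> nat \<Rightarrow> nat \<Rightarrow> real \<Rightarrow> 'a \<times> complex" where
  "edge_loop h n m = loop_join (chart n h \<circ> descent n m) (chart m h \<circ> linepath (lower m) (upper m))"

lemma linepath_upper: "Im (linepath (upper m) (upper n) s) = 1/2"
  by (simp add: linepath_def upper_def algebra_simps)

lemma linepath_lower: "Im (linepath (lower m) (lower n) s) = -1/2"
  by (simp add: linepath_def lower_def algebra_simps)

lemma linepath_vertical:
  "linepath (upper n) (lower n) s = Complex (real n) (1/2 - s)"
  "linepath (lower n) (upper n) s = Complex (real n) (s - 1/2)"
  by (simp_all add: linepath_def lower_def upper_def complex_eq_iff algebra_simps)

lemma path_image_descent: "path_image (descent n m) \<subseteq> slit_plane n"
proof -
  have "linepath (upper m) (upper n) s \<in> slit_plane n" "linepath (lower n) (lower m) s \<in> slit_plane n" for s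
    by (auto intro!: slit_plane_memI simp: linepath_upper linepath_lower)
  moreover have "linepath (upper n) (lower n) s \<in> slit_plane n" for s
    by (simp add: linepath_vertical slit_plane_def)
  ultimately show ?thesis
    unfolding descent_def by (auto simp: path_image_def joinpaths_def)
qed

lemma path_image_ascent: "path_image (linepath (lower m) (upper m)) \<subseteq> strip m"
  unfolding path_image_def by (auto simp: linepath_vertical strip_def)

lemma pathin_chart:
  assumes "h \<in> carrier G" "path \<gamma>" "path_image \<gamma> \<subseteq> slit_plane n"
  shows "pathin S (chart n h \<circ> \<gamma>)"
  unfolding pathin_def
proof (rule continuous_map_compose[OF _ continuous_map_chart[OF assms(1)]])
  show "continuous_map (top_of_set {0..1}) (top_of_set (slit_plane n)) \<gamma>"
    using assms(2,3) by (auto simp: path_def path_image_def)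
qed

lemma descent_ends: "descent n m 0 = upper m" "descent n m 1 = lower m" "path (descent n m)"
proof -
  show "descent n m 0 = upper m"
    by (simp add: descent_def joinpaths_def linepath_def)
  show "descent n m 1 = lower m"
    by (simp add: descent_def joinpaths_def linepath_def)
  show "path (descent n m)" by (simp add: descent_def)
qed

context
  fixes h n m
  assumes h: "h \<in> carrier G" and tt: "t n = t m" and nm: "n \<noteq> m"
begin

lemma pathin_pieces:
  "pathin S (chart n h \<circ> descent n m)" "pathin S (chart m h \<circ> linepath (lower m) (upper m))"
  "(chart n h \<circ> descent n m) 1 = (chart m h \<circ> linepath (lower m) (upper m)) 0"
proof -
  show "pathin S (chart n h \<circ> descent n m)"
    by (intro pathin_chart h descent_ends path_image_descent)
  show "pathin S (chart m h \<circ> linepath (lower m) (upper m))"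
    using path_image_ascent strip_subset by (intro pathin_chart h) auto
  show "(chart n h \<circ> descent n m) 1 = (chart m h \<circ> linepath (lower m) (upper m)) 0"
    by (simp add: descent_ends linepath_0' chart_def lower_def tt)
qed

lemma edge_loop_loops: "edge_loop h n m \<in> loops S (h, upper m)"
proof -
  have "edge_loop h n m 0 = (h, upper m)" "edge_loop h n m 1 = (h, upper m)"
    by (simp_all add: edge_loop_def loop_join_def descent_ends linepath_1' chart_def upper_def)
  moreover have "pathin S (edge_loop h n m)"
    unfolding edge_loop_def by (rule pathin_loop_join[OF pathin_pieces])
  ultimately show ?thesis by (simp add: loops_def)
qed

lemma edge_loop_values:
  assumes "s \<in> {0..1}"
  shows "(\<exists>z\<in>slit_plane n. edge_loop h n m s = chart n h z) \<or> (\<exists>z\<in>strip m. edge_loop h n m s = chart m h z)"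
proof (cases "s \<le> 1/2")
  case True
  then have "descent n m (2 * s) \<in> path_image (descent n m)" using assms by (auto simp: path_image_def)
  then show ?thesis using True path_image_descent by (auto simp: edge_loop_def loop_join_def)
next
  case False
  then have "linepath (lower m) (upper m) (2 * s - 1) \<in> path_image (linepath (lower m) (upper m))"
    using assms unfolding path_image_def by (intro imageI) auto
  then show ?thesis using False path_image_ascent by (auto simp: edge_loop_def loop_join_def)
qed

text \<open>Along the loop the map \<open>edge_map n h\<close> is constantly \<open>1\<close>, except on the vertical part of the
  descent, where it follows the unit circle exactly once.\<close>

lemma winding_number_edge_loop: "winding_number (edge_map n h \<circ> edge_loop h n m) 0 = 1"
proof -
  have v: "bump n (linepath (upper n) (lower n) s) = circlepath 0 1 s" if "s \<in> {0..1}" for s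
  proof -
    have m: "max (1/2) \<bar>1/2 - s\<bar> = 1/2" using that by (auto simp: abs_if)
    have "(1 - (1/2 - s) / (1/2)) / 2 = s" by (simp add: field_simps)
    then show ?thesis by (simp add: bump_def linepath_vertical circlepath m)
  qed
  have u: "bump n (linepath (upper m) (upper n) s) = 1" "bump n (linepath (lower n) (lower m) s) = 1" for s
    by (rule bump_eq_1; simp add: linepath_upper linepath_lower)+
  have "winding_number (edge_map n h \<circ> (chart n h \<circ> descent n m)) 0 =
      winding_number (linepath 1 1 +++ (circlepath 0 1 +++ linepath 1 1)) 0"
  proof (rule winding_number_cong)
    fix s :: real assume s: "0 \<le> s" "s \<le> 1"
    have "descent n m s \<in> slit_plane n" using path_image_descent[of n m] s unfolding path_image_def by (simp add: image_subset_iff)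
    then have "(edge_map n h \<circ> (chart n h \<circ> descent n m)) s = bump n (descent n m s)"
      by (simp add: edge_map_chart h)
    also have "\<dots> = (linepath 1 1 +++ (circlepath 0 1 +++ linepath 1 1)) s"
    proof -
      consider "s \<le> 1/2" | "1/2 < s" "2 * s - 1 \<le> 1/2" | "1/2 < s" "1/2 < 2 * s - 1" by linarith
      then show ?thesis
      proof cases
        case 1
        then show ?thesis using u by (simp add: descent_def joinpaths_def linepath_def[of 1])
      next
        case 2
        then show ?thesis using v[of "2 * (2 * s - 1)"] by (simp add: descent_def joinpaths_def)
      next
        case 3
        then show ?thesis using u by (simp add: descent_def joinpaths_def linepath_def[of 1])
      qed
    qed
    finally show "(edge_map n h \<circ> (chart n h \<circ> descent n m)) s = (linepath 1 1 +++ (circlepath 0 1 +++ linepath 1 1)) s" .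
  qed
  also have "\<dots> = 1"
    by (simp add: winding_number_join path_image_join winding_number_circlepath_centre)
  finally have 1: "winding_number (edge_map n h \<circ> (chart n h \<circ> descent n m)) 0 = 1" .
  have 2: "winding_number (edge_map n h \<circ> (chart m h \<circ> linepath (lower m) (upper m))) 0 = 0"
  proof (rule winding_number_constI)
    fix s :: real
    have "linepath (lower m) (upper m) s \<in> strip m" by (simp add: linepath_vertical strip_def)
    then have "linepath (lower m) (upper m) s \<notin> strip n" using strip_disjoint nm by blast
    then show "(edge_map n h \<circ> (chart m h \<circ> linepath (lower m) (upper m))) s = 1"
      by (simp add: edge_map_outside_strip)
  qed auto
  show ?thesis
    unfolding edge_loop_def winding_number_loop_join[OF continuous_map_edge_map[OF h] pathin_pieces] 1 2
    by simp
qed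

text \<open>The translated loop crosses the \<open>n\<close>-th interval of the upper sheet of \<open>k \<otimes> h\<close>, which is not that
  of \<open>h\<close>.\<close>

lemma winding_number_deck_edge_loop:
  assumes k: "k \<in> carrier G" "k \<noteq> \<one>"
  shows "winding_number (edge_map n h \<circ> deck k \<circ> edge_loop h n m) 0 = 0"
proof (rule winding_number_constI)
  fix s :: real assume s: "0 \<le> s" "s \<le> 1"
  have kh: "k \<otimes> h \<in> carrier G" "k \<otimes> h \<noteq> h" using k h by auto
  consider z where "z \<in> slit_plane n" "edge_loop h n m s = chart n h z"
    | z where "z \<in> strip m" "edge_loop h n m s = chart m h z"
    using edge_loop_values[of s] s by auto
  then show "(edge_map n h \<circ> deck k \<circ> edge_loop h n m) s = 1"
  proof cases
    case 1
    then show ?thesis using kh k h by (simp add: deck_chart edge_map_chart)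
  next
    case 2
    then have "z \<notin> strip n" using strip_disjoint nm by blast
    then show ?thesis using 2 by (simp add: deck_def edge_map_outside_strip)
  qed
qed auto

end

lemma infinite_indices:
  assumes "g \<in> carrier G" obtains n where "t n = g" "n \<noteq> m"
proof -
  have "infinite ({n. t n = g} - {m})" using t_infinite[OF assms] by simp
  then have "{n. t n = g} - {m} \<noteq> {}" by (rule infinite_imp_nonempty)
  then show thesis using that by blast
qed

lemma deck_not_homotopic_id:
  assumes k: "k \<in> carrier G" "k \<noteq> \<one>"
  shows "\<not> homotopic_with (\<lambda>h. True) S S (deck k) id"
proof -
  obtain m where m: "t m = \<one>" using infinite_indices[OF one_closed] by metis
  obtain n where n: "t n = \<one>" "n \<noteq> m" using infinite_indices[OF one_closed] by metis
  have nm: "t n = t m" using m n by simp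
  have l: "pathin S (edge_loop \<one> n m)" "edge_loop \<one> n m 0 = edge_loop \<one> n m 1"
    using edge_loop_loops[OF one_closed nm n(2)] by (auto simp: loops_def)
  show ?thesis
    by (rule not_homotopic_id[OF continuous_map_edge_map[OF one_closed, of n] l])
      (simp add: winding_number_edge_loop winding_number_deck_edge_loop nm n(2) k)
qed

text \<open>A loop projects to a bounded subset of the plane, so it meets only finitely many strips; on the
  other hand, all but one of the infinitely many \<open>n\<close> with \<open>t n = \<one>\<close> have a loop crossing once.\<close>

lemma infinite_type_S: "infinite_type S"
proof -
  obtain m where m: "t m = \<one>" using infinite_indices[OF one_closed] by metis
  have a: "(\<one>, upper m) \<in> topspace S"
    using chart_in[OF one_closed, of "upper m" m] slit_plane_memI[of "upper m" m]
    by (simp add: topspace_S chart_def upper_def)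
  have "\<not> finitely_generated_group (fundamental_group S (\<one>, upper m))"
  proof (rule not_finitely_generated_fundamental_group[OF a continuous_map_edge_map[OF one_closed]])
    fix p assume "p \<in> loops S (\<one>, upper m)"
    then have "continuous_map (top_of_set {0..1}) S p"
      by (simp add: loops_def pathin_def)
    then have "continuous_map (top_of_set {0..1}) euclidean (snd \<circ> p)"
      using continuous_map_snd_S by (rule continuous_map_compose)
    then have "continuous_on {0..1} (snd \<circ> p)" by simp
    then have "bounded ((snd \<circ> p) ` {0..1})"
      by (intro compact_imp_bounded compact_continuous_image) auto
    then obtain b where "\<forall>z\<in>(snd \<circ> p) ` {0..1}. norm z \<le> b"
      unfolding bounded_iff by blast
    then have b: "norm (snd (p s)) \<le> b" if "s \<in> {0..1}" for s using that by auto
    obtain N :: nat where N: "b + 1 \<le> real N" using real_arch_simple by blast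
    have "winding_number (edge_map n \<one> \<circ> p) 0 = 0" if "N \<le> n" for n
    proof (rule winding_number_constI)
      fix s :: real assume "0 \<le> s" "s \<le> 1"
      then have "Re (snd (p s)) \<le> b" using b[of s] complex_Re_le_cmod order_trans by (metis atLeastAtMost_iff)
      then have "snd (p s) \<notin> strip n" using N \<open>N \<le> n\<close> by (auto simp: strip_def)
      then show "(edge_map n \<one> \<circ> p) s = 1" by (simp add: edge_map_outside_strip)
    qed auto
    then have "{n. winding_number (edge_map n \<one> \<circ> p) 0 \<noteq> 0} \<subseteq> {..<N}"
      by (metis (mono_tags, lifting) lessThan_iff mem_Collect_eq not_le subsetI)
    then show "finite {n. winding_number (edge_map n \<one> \<circ> p) 0 \<noteq> 0}"
      using finite_subset by blast
  next
    have "{n. t n = \<one>} - {m} \<subseteq> {n. \<exists>p\<in>loops S (\<one>, upper m). winding_number (edge_map n \<one> \<circ> p) 0 \<noteq> 0}"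
    proof
      fix n assume "n \<in> {n. t n = \<one>} - {m}"
      then have nm: "t n = t m" "n \<noteq> m" using m by auto
      show "n \<in> {n. \<exists>p\<in>loops S (\<one>, upper m). winding_number (edge_map n \<one> \<circ> p) 0 \<noteq> 0}"
        using edge_loop_loops[OF one_closed nm] winding_number_edge_loop[OF one_closed nm] by force
    qed
    moreover have "infinite ({n. t n = \<one>} - {m})" using t_infinite[OF one_closed] by simp
    ultimately show "infinite {n. \<exists>p\<in>loops S (\<one>, upper m). winding_number (edge_map n \<one> \<circ> p) 0 \<noteq> 0}"
      by (rule infinite_super)
  qed
  then show ?thesis using a by (auto simp: infinite_type_def)
qed

end


section \<open>Countable groups as subgroups of mapping class groups\<close>

theorem theorem7:
  fixes G :: "('g, 'm) monoid_scheme"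
  assumes "group G" and "countable (carrier G)"
  shows "\<exists>S :: (nat \<times> complex) topology.
           surface S \<and> connected_space S \<and> orientable S \<and> infinite_type S \<and>
           (\<exists>H. subgroup H (mapping_class_group S) \<and>
                G \<cong> (mapping_class_group S)\<lparr>carrier := H\<rparr>)"
proof -
  \<comment> \<open>The points of the surface are pairs in \<open>nat \<times> complex\<close>, so \<open>G\<close> is replaced by an isomorphic
    group of natural numbers.\<close>
  define K where "K = image_group (to_nat_on (carrier G)) G"
  have inj: "inj_on (to_nat_on (carrier G)) (carrier G)"
    using assms(2) by (rule inj_on_to_nat_on)
  have GK: "G \<cong> K"
    unfolding K_def using inj_imp_image_group_iso[OF inj] by (rule is_isoI)
  interpret K: group K
    unfolding K_def using group.inj_imp_image_group_is_group[OF assms(1) inj] .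
  \<comment> \<open>Enumerating pairs and forgetting the second component repeats every value infinitely often.\<close>
  define t where "t i = from_nat_into (carrier K) (fst (prod_decode i))" for i
  have ne: "carrier K \<noteq> {}" using K.one_closed by blast
  interpret cayley_surface K t
  proof
    show "t i \<in> carrier K" for i unfolding t_def by (rule from_nat_into[OF ne])
    fix g assume g: "g \<in> carrier K"
    obtain i where i: "from_nat_into (carrier K) i = g"
      using from_nat_into_surj[OF countableI_type g] by metis
    have "range (\<lambda>j. prod_encode (i, j)) \<subseteq> {n. t n = g}" by (auto simp: t_def i)
    moreover have "infinite (range (\<lambda>j. prod_encode (i, j)))"
      by (rule range_inj_infinite) (simp add: inj_on_def)
    ultimately show "infinite {n. t n = g}" by (rule infinite_super)
  qed
  have "\<exists>H. subgroup H (mapping_class_group S) \<and> K \<cong> (mapping_class_group S)\<lparr>carrier := H\<rparr>"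
  proof (rule action_embeds_in_mapping_class_group[where d = deck])
    show "group K" by (rule K.is_group)
  qed (simp_all add: deck_homeos_plus deck_deck deck_not_homotopic_id)
  then have "\<exists>H. subgroup H (mapping_class_group S) \<and> G \<cong> (mapping_class_group S)\<lparr>carrier := H\<rparr>"
    using iso_trans[OF GK] by blast
  then show ?thesis
    using spread_surface[OF second_countable_S] connected_S spread_orientable infinite_type_S by blast
qed

end
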